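(* Let $X=(X_i)_{i\ge1}$ be a stationary process with values in a measurable space $E$, let $(\mathcal Y,\|\cdot\|)$ be a separable normed vector space, and for each $n\ge1$ let $S_n\Phi:E^{\mathbb N_+}\to\mathcal Y$ be measurable. Let $\mu_n$ be the distribution of $S_n\Phi(X)/n$. Let $(k(n))_{n\ge1}$ be an increasing sequence of positive integers and let $\mu_n^\omega$ be the empirical measures defined in the context. Assume: (i) $(\mu_n)_{n\ge1}$ satisfies in $\mathcal Y$ the large deviation principle (LDP) with rate function $I$; (ii) $M_h=\int_0^1(\alpha_X^{-1}(u))^h\,du<\infty$ for all $h>0$; (iii) there exists a sequence $(S_n\Phi_n)_{n\ge1}$ of measurable functions from $E^{\mathbb N_+}$ to $\mathcal Y$ such that each $S_n\Phi_n$ depends only on the first $2n$ coordinates and $\delta_n=\sup_{z\in E^{\mathbb N_+}}\|S_n\Phi(z)-S_n\Phi_n(z)\|/n\to0$ as $n\to\infty$. Suppose that either $\sup_{x\in\mathcal D_I}I(x)<\infty$ and $\liminf_{n\to\infty}\frac{\log k(n)}n>\sup_{x\in\mathcal D_I}I(x)$, or $\lim_{n\to\infty}\frac{\log k(n)}n=\infty$. Then, with probability 1, $(\mu_n^\omega)_{n\ge1}$ satisfies in $\mathcal Y$ the weak LDP with rate function $I$. If, moreover, $(\mu_n)_{n\ge1}$ is exponentially tight, then, with probability 1, $(\mu_n^\omega)_{n\ge1}$ satisfies in $\mathcal Y$ the LDP with good rate function $I$.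
   Context: $\mathbb N_+$ is the set of positive integers; $X$ is defined on a probability space $(\Omega,\mathcal A,\mathbb P)$; $T(x_1,x_2,\dots)=(x_2,x_3,\dots)$ is the shift on $E^{\mathbb N_+}$. $\mathcal Y$ carries its completed Borel $\sigma$-field $B_{\mathcal Y}$. (In the paper $S_n\Phi(X)$ is a measurable function of $(X,TX,\dots,T^{n-1}X)$; a typical example is a Birkhoff sum $\sum_{j=0}^{n-1}\Phi(T^jX)$.) Mixing: for sub-$\sigma$-algebras $\mathcal U,\mathcal V$ of $\mathcal A$, $\alpha(\mathcal U,\mathcal V)=\sup\{|\mathbb P(U)\mathbb P(V)-\mathbb P(U\cap V)|:U\in\mathcal U,V\in\mathcal V\}$. Set $\alpha_{X,0}=1/2$ and, for $m\ge1$, $\alpha_{X,m}=\sup\{\alpha(\sigma(X_k:k\le i),\sigma(X_j:j\ge i+m)):i\ge1\}$. For $u\in[0,1]$, $\alpha_X^{-1}(u)=\inf\{m:\alpha_{X,m}\le u\}$. Empirical measures: $\mu_n^\omega=\frac1{k(n)}\sum_{j=1}^{k(n)}\delta_{x_{n,j}(\omega)}$ with $x_{n,j}(\omega)=S_n\Phi(T^{(j-1)n}X(\omega))/n$. LDP: for a lower semicontinuous $I:\mathcal Y\to[0,\infty]$, $\mathcal D_I=\{x:I(x)<\infty\}$, and $(\mu_n)$ satisfies the LDP with rate function $I$ if for all $\Gamma\in B_{\mathcal Y}$, $-\inf_{\mathring\Gamma}I\le\liminf_n\frac1n\log\mu_n(\Gamma)\le\limsup_n\frac1n\log\mu_n(\Gamma)\le-\inf_{\overline\Gamma}I$.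 The weak LDP with rate function $I$ is the same requirement with the upper bound demanded only for compact $\Gamma$ (the lower bound being demanded for all $\Gamma\in B_{\mathcal Y}$). $I$ is a good rate function if moreover all level sets $\{I\le\alpha\}$, $\alpha\in\mathbb R_+$, are compact. $(\mu_n)$ is exponentially tight if for every $\alpha<\infty$ there is a compact $K_\alpha\subset\mathcal Y$ with $\limsup_n\frac1n\log\mu_n(K_\alpha^c)\le-\alpha$. *)

theory Defs
  imports "HOL-Probability.Probability"
begin

section \<open>Processes indexed by the positive integers\<close>

text \<open>\<open>E\<^sup>\<nat>\<close> (positive indices) is the product measurable space over \<open>{1..}\<close>; its elements
  are functions on \<open>nat\<close> that are \<open>undefined\<close> at \<open>0\<close>.\<close>

abbreviation seq_space :: "'e measure \<Rightarrow> (nat \<Rightarrow> 'e) measure" where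
  "seq_space E \<equiv> PiM {1..} (\<lambda>_. E)"

definition shift :: "(nat \<Rightarrow> 'e) \<Rightarrow> nat \<Rightarrow> 'e" where
  "shift x = (\<lambda>i\<in>{1..}. x (Suc i))"

definition path :: "(nat \<Rightarrow> 'a \<Rightarrow> 'e) \<Rightarrow> 'a \<Rightarrow> nat \<Rightarrow> 'e" where
  "path X \<omega> = (\<lambda>i\<in>{1..}. X i \<omega>)"

definition stationary_process ::
    "'a measure \<Rightarrow> 'e measure \<Rightarrow> (nat \<Rightarrow> 'a \<Rightarrow> 'e) \<Rightarrow> bool" where
  "stationary_process M E X \<longleftrightarrow>
     (\<forall>i\<ge>1. X i \<in> measurable M E) \<and>
     distr M (seq_space E) (\<lambda>\<omega>. shift (path X \<omega>)) = distr M (seq_space E) (path X)"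

lemma funpow_shift_path: "(shift ^^ m) (path X \<omega>) = (\<lambda>i\<in>{1..}. X (i + m) \<omega>)"
  by (induction m) (auto simp: shift_def path_def fun_eq_iff)

section \<open>Strong mixing\<close>

definition alpha_coeff :: "'a measure \<Rightarrow> 'a set set \<Rightarrow> 'a set set \<Rightarrow> real" where
  "alpha_coeff M U V =
     (SUP (A, B) \<in> U \<times> V. \<bar>measure M A * measure M B - measure M (A \<inter> B)\<bar>)"

definition sigma_proc ::
    "'a measure \<Rightarrow> 'e measure \<Rightarrow> (nat \<Rightarrow> 'a \<Rightarrow> 'e) \<Rightarrow> nat set \<Rightarrow> 'a set set" where
  "sigma_proc M E X J =
     sigma_sets (space M) (\<Union>k\<in>J. {X k -` A \<inter> space M | A. A \<in> sets E})"

definition alpha_mix ::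
    "'a measure \<Rightarrow> 'e measure \<Rightarrow> (nat \<Rightarrow> 'a \<Rightarrow> 'e) \<Rightarrow> nat \<Rightarrow> real" where
  "alpha_mix M E X m =
     (if m = 0 then 1 / 2
      else (SUP i \<in> {1..}. alpha_coeff M (sigma_proc M E X {1..i}) (sigma_proc M E X {i + m..})))"

text \<open>The generalised inverse takes the value \<open>\<infinity>\<close> when no \<open>m\<close> qualifies; hence the
  value type \<^typ>\<open>ennreal\<close>, in which \<open>Inf {} = \<infinity>\<close>.\<close>

definition alpha_inv ::
    "'a measure \<Rightarrow> 'e measure \<Rightarrow> (nat \<Rightarrow> 'a \<Rightarrow> 'e) \<Rightarrow> real \<Rightarrow> ennreal" where
  "alpha_inv M E X u = (INF m \<in> {m. alpha_mix M E X m \<le> u}. of_nat m)"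

text \<open>Real powers on \<open>[0, \<infinity>]\<close>; only meant for positive exponents.\<close>

definition ennreal_powr :: "ennreal \<Rightarrow> real \<Rightarrow> ennreal" where
  "ennreal_powr x h = (if x = \<infinity> then \<infinity> else ennreal (enn2real x powr h))"

definition mixing_moment ::
    "'a measure \<Rightarrow> 'e measure \<Rightarrow> (nat \<Rightarrow> 'a \<Rightarrow> 'e) \<Rightarrow> real \<Rightarrow> ennreal" where
  "mixing_moment M E X h = (\<integral>\<^sup>+ u \<in> {0..1}. ennreal_powr (alpha_inv M E X u) h \<partial>lborel)"

section \<open>Large deviation principles\<close>

text \<open>The completed Borel sigma-field is read as the universal completion, so that it depends
  on the space only; a measure on the Borel sets is evaluated on it through its completion.\<close>

definition completed_borel :: "'y::topological_space set set" where
  "completed_borel =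
     {\<Gamma>. \<forall>\<nu>. prob_space \<nu> \<and> sets \<nu> = sets borel \<longrightarrow> \<Gamma> \<in> sets (completion \<nu>)}"

lemma borel_subset_completed_borel: "sets borel \<subseteq> completed_borel"
  by (auto simp: completed_borel_def)

text \<open>Logarithm of a probability, with \<open>log 0 = -\<infinity>\<close>.\<close>

definition elog :: "real \<Rightarrow> ereal" where
  "elog p = (if p = 0 then -\<infinity> else ereal (ln p))"

definition log_rate :: "(nat \<Rightarrow> 'y measure) \<Rightarrow> 'y set \<Rightarrow> nat \<Rightarrow> ereal" where
  "log_rate \<mu> \<Gamma> n = ereal (1 / real n) * elog (measure (completion (\<mu> n)) \<Gamma>)"

definition lsc :: "('y::topological_space \<Rightarrow> ereal) \<Rightarrow> bool" where
  "lsc I \<longleftrightarrow> (\<forall>x. \<forall>c < I x. \<forall>\<^sub>F y in nhds x. c < I y)"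

definition rate_function :: "('y::topological_space \<Rightarrow> ereal) \<Rightarrow> bool" where
  "rate_function I \<longleftrightarrow> (\<forall>x. 0 \<le> I x) \<and> lsc I"

definition good_rate_function :: "('y::topological_space \<Rightarrow> ereal) \<Rightarrow> bool" where
  "good_rate_function I \<longleftrightarrow> rate_function I \<and> (\<forall>c::real. 0 \<le> c \<longrightarrow> compact {x. I x \<le> ereal c})"

definition finite_domain :: "('y \<Rightarrow> ereal) \<Rightarrow> 'y set" where
  "finite_domain I = {x. I x < \<infinity>}"

definition LDP_lower ::
    "(nat \<Rightarrow> 'y::topological_space measure) \<Rightarrow> ('y \<Rightarrow> ereal) \<Rightarrow> bool" where
  "LDP_lower \<mu> I \<longleftrightarrow>
     (\<forall>\<Gamma>\<in>completed_borel. - (INF x \<in> interior \<Gamma>. I x) \<le> liminf (log_rate \<mu> \<Gamma>))"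

definition LDP ::
    "(nat \<Rightarrow> 'y::topological_space measure) \<Rightarrow> ('y \<Rightarrow> ereal) \<Rightarrow> bool" where
  "LDP \<mu> I \<longleftrightarrow> rate_function I \<and> LDP_lower \<mu> I \<and>
     (\<forall>\<Gamma>\<in>completed_borel. limsup (log_rate \<mu> \<Gamma>) \<le> - (INF x \<in> closure \<Gamma>. I x))"

definition weak_LDP ::
    "(nat \<Rightarrow> 'y::topological_space measure) \<Rightarrow> ('y \<Rightarrow> ereal) \<Rightarrow> bool" where
  "weak_LDP \<mu> I \<longleftrightarrow> rate_function I \<and> LDP_lower \<mu> I \<and>
     (\<forall>\<Gamma>\<in>completed_borel. compact \<Gamma> \<longrightarrow>
        limsup (log_rate \<mu> \<Gamma>) \<le> - (INF x \<in> closure \<Gamma>. I x))"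

definition exponentially_tight :: "(nat \<Rightarrow> 'y::topological_space measure) \<Rightarrow> bool" where
  "exponentially_tight \<mu> \<longleftrightarrow>
     (\<forall>c::real. \<exists>K. compact K \<and> limsup (log_rate \<mu> (- K)) \<le> - ereal c)"

section \<open>Laws and empirical measures\<close>

definition mu_law ::
    "'a measure \<Rightarrow> (nat \<Rightarrow> 'a \<Rightarrow> 'e) \<Rightarrow> (nat \<Rightarrow> (nat \<Rightarrow> 'e) \<Rightarrow> 'y::real_normed_vector)
      \<Rightarrow> nat \<Rightarrow> 'y measure" where
  "mu_law M X S n = distr M borel (\<lambda>\<omega>. S n (path X \<omega>) /\<^sub>R real n)"

definition sample ::
    "(nat \<Rightarrow> 'a \<Rightarrow> 'e) \<Rightarrow> (nat \<Rightarrow> (nat \<Rightarrow> 'e) \<Rightarrow> 'y::real_normed_vector)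
      \<Rightarrow> 'a \<Rightarrow> nat \<Rightarrow> nat \<Rightarrow> 'y" where
  "sample X S \<omega> n j = S n ((shift ^^ ((j - 1) * n)) (path X \<omega>)) /\<^sub>R real n"

definition empirical_measure :: "nat \<Rightarrow> (nat \<Rightarrow> 'y::topological_space) \<Rightarrow> 'y measure" where
  "empirical_measure N x =
     measure_of UNIV (sets borel) (\<lambda>A. (\<Sum>j=1..N. emeasure (return borel (x j)) A) / of_nat N)"

lemma
  shows space_empirical_measure [simp]: "space (empirical_measure N x) = UNIV"
    and sets_empirical_measure [simp]: "sets (empirical_measure N x) = sets borel"
  unfolding empirical_measure_def
  using sets.sigma_sets_eq[of borel] by (simp_all add: space_measure_of_conv)

lemma emeasure_empirical_measure:
  assumes "A \<in> sets borel"
  shows "emeasure (empirical_measure N x) A =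
    (\<Sum>j=1..N. emeasure (return borel (x j)) A) / of_nat N"
proof (rule emeasure_measure_of[OF empirical_measure_def])
  show "A \<in> sets (empirical_measure N x)" using assms by simp
  show "countably_additive (sets (empirical_measure N x))
      (\<lambda>A. (\<Sum>j=1..N. emeasure (return borel (x j)) A) / of_nat N)"
    unfolding countably_additive_def
  proof (intro allI impI)
    fix B :: "nat \<Rightarrow> 'a set"
    assume B: "range B \<subseteq> sets (empirical_measure N x)" "disjoint_family B"
    then have "(\<Sum>i. emeasure (return borel (x j)) (B i)) = emeasure (return borel (x j)) (\<Union>i. B i)" for j
      by (intro suminf_emeasure) auto
    then have "(\<Sum>i. \<Sum>j=1..N. emeasure (return borel (x j)) (B i))
        = (\<Sum>j=1..N. emeasure (return borel (x j)) (\<Union>i. B i))"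
      by (subst suminf_sum) auto
    then show "(\<Sum>i. (\<Sum>j=1..N. emeasure (return borel (x j)) (B i)) / of_nat N)
        = (\<Sum>j=1..N. emeasure (return borel (x j)) (\<Union>i. B i)) / of_nat N"
      by simp
  qed
qed (auto simp: positive_def)

end

theory Submission
  imports Defs "HOL-Real_Asymp.Real_Asymp"
begin

text \<open>
  Both bounds are proved for one set at a time, almost surely, and then transferred to all sets by
  means of countably many balls, since \<open>'y\<close> has a countable dense set.

  \<^bold>\<open>Upper bound.\<close> By stationarity the mean of \<open>\<mu>\<^sub>n\<^sup>\<omega>(B)\<close> is \<open>\<mu>\<^sub>n(B)\<close>. Markov's inequality shows
  that \<open>\<mu>\<^sub>n\<^sup>\<omega>(B)\<close> exceeds \<open>\<mu>\<^sub>n(B)\<close> by an exponential factor only with exponentially small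
  probability, so Borel--Cantelli gives, for a fixed Borel set \<open>B\<close>, that almost surely the upper
  exponential rate of \<open>\<mu>\<^sub>n\<^sup>\<omega>(B)\<close> is at most that of \<open>\<mu>\<^sub>n(B)\<close> (\<open>AE_limsup_log_rate_le\<close>).
  Applied to countably many closed balls this bounds the rates of all compact sets, because
  \<open>I\<close> is lower semicontinuous. Applied to the complements of countably many compact sets it
  transfers exponential tightness from \<open>(\<mu>\<^sub>n)\<close> to \<open>(\<mu>\<^sub>n\<^sup>\<omega>)\<close>, which turns the weak principle into the
  full one.

  \<^bold>\<open>Lower bound.\<close> Let a ball have \<open>\<mu>\<^sub>n\<close>-mass at least \<open>exp (- c n)\<close>, let \<open>k(n) \<ge> exp (d n)\<close> and let \<open>c < d\<close>.
  After replacing \<open>S\<^sub>n\<Phi>\<close> by its finite-window approximation, at the price of a slightly larger ball, the visits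
  of the observations to the ball are events of a common probability \<open>p\<^sub>n \<ge> exp (- c n)\<close>, the \<open>j\<close>-th one
  determined by the coordinates from \<open>(j - 1) n + 1\<close> to \<open>(j + 1) n\<close>. In the variance of the number of visits, the pairs of
  indices at distance at most \<open>l\<close> contribute at most \<open>p\<^sub>n\<close> each and all others at most \<open>\<alpha>\<^sub>l\<close> each, so
  by Chebyshev there are at most \<open>k(n) p\<^sub>n / 2\<close> visits with probability of order
  \<open>l / (k(n) p\<^sub>n) + \<alpha>\<^sub>l / p\<^sub>n\<^sup>2\<close>. The moment condition makes \<open>\<alpha>\<^sub>l\<close> decay faster than every power of \<open>l\<close>.
  Hence an exponentially long distance \<open>l = exp (e n)\<close> with \<open>e = (d - c) / 2\<close> makes both terms
  exponentially small: the first because \<open>k(n) p\<^sub>n \<ge> exp (2 e n)\<close>, the second by taking a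
  sufficiently high power. Borel--Cantelli then gives the enlarged ball an empirical mass of at least
  \<open>p\<^sub>n / 2\<close> for all large \<open>n\<close>
  (\<open>AE_liminf_log_rate_ball_ge\<close>).
\<close>

section \<open>Logarithmic rates\<close>

lemma elog_le_iff:
  assumes "0 \<le> p"
  shows "elog p \<le> ereal c \<longleftrightarrow> p \<le> exp c" and "ereal c \<le> elog p \<longleftrightarrow> exp c \<le> p"
proof -
  have "ln p \<le> c \<longleftrightarrow> p \<le> exp c" "c \<le> ln p \<longleftrightarrow> exp c \<le> p" if "p \<noteq> 0"
    using assms that by (metis exp_le_cancel_iff exp_ln order_le_less)+
  then show "elog p \<le> ereal c \<longleftrightarrow> p \<le> exp c" "ereal c \<le> elog p \<longleftrightarrow> exp c \<le> p"
    by (auto simp: elog_def not_le less_imp_le)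
qed

lemma log_rate_le_iff:
  assumes "1 \<le> n"
  shows "log_rate \<mu> \<Gamma> n \<le> ereal c \<longleftrightarrow> measure (completion (\<mu> n)) \<Gamma> \<le> exp (c * n)"
    and "ereal c \<le> log_rate \<mu> \<Gamma> n \<longleftrightarrow> exp (c * n) \<le> measure (completion (\<mu> n)) \<Gamma>"
proof -
  have *: "ereal (1 / real n) * x \<le> ereal c \<longleftrightarrow> x \<le> ereal (c * n)"
      "ereal c \<le> ereal (1 / real n) * x \<longleftrightarrow> ereal (c * n) \<le> x" for x
    using assms by (cases x; simp add: field_simps)+
  show "log_rate \<mu> \<Gamma> n \<le> ereal c \<longleftrightarrow> measure (completion (\<mu> n)) \<Gamma> \<le> exp (c * n)"
    "ereal c \<le> log_rate \<mu> \<Gamma> n \<longleftrightarrow> exp (c * n) \<le> measure (completion (\<mu> n)) \<Gamma>"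
    unfolding log_rate_def * by (simp_all add: elog_le_iff)
qed

text \<open>The bounds of a large deviation principle have the form \<open>- Inf I\<close>. This rule and the next one
  reduce them to real constants, which can be compared with exponentials.\<close>

lemma ereal_le_uminusI:
  fixes x m :: ereal
  assumes "\<And>c::real. ereal c < m \<Longrightarrow> x \<le> - ereal c"
  shows "x \<le> - m"
proof (rule dense_ge)
  fix z assume "- m < z"
  then have "- z < m" using ereal_uminus_less_reorder by blast
  then obtain c where "- z < ereal c" "ereal c < m" using ereal_dense2 by blast
  then have "x \<le> - ereal c" "- ereal c \<le> z"
    using assms ereal_uminus_less_reorder by (auto intro: less_imp_le simp del: uminus_ereal.simps)
  then show "x \<le> z" by (rule order_trans)
qed

lemma ereal_uminus_leI:
  fixes x m :: ereal
  assumes "\<And>c::real. m < ereal c \<Longrightarrow> - ereal c \<le> x"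
  shows "- m \<le> x"
  using ereal_le_uminusI[of "-m" "-x"] assms
  by (metis ereal_uminus_le_reorder ereal_uminus_less_reorder ereal_uminus_uminus uminus_ereal.simps(1))

lemma sets_borel_completion:
  assumes "\<Gamma> \<in> completed_borel" "prob_space \<nu>" "sets \<nu> = sets borel"
  shows "\<Gamma> \<in> sets (completion \<nu>)"
  using assms by (auto simp: completed_borel_def)

text \<open>Laws with index \<open>0\<close> are left arbitrary: \<open>S 0\<close> need not be measurable, so \<open>mu_law M X S 0\<close> may fail
  to be a probability measure. Limits are not affected.\<close>

locale borel_prob_sequence =
  fixes \<nu> :: "nat \<Rightarrow> 'y::real_normed_vector measure"
  assumes prob: "1 \<le> n \<Longrightarrow> prob_space (\<nu> n)"
    and sets_eq: "1 \<le> n \<Longrightarrow> sets (\<nu> n) = sets borel"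
begin

text \<open>A set outside the completed sigma-algebra has measure \<open>0\<close> by convention, so measurability of the
  larger set suffices.\<close>

lemma measure_completion_mono:
  assumes "A \<subseteq> B" "B \<in> completed_borel" "1 \<le> n"
  shows "measure (completion (\<nu> n)) A \<le> measure (completion (\<nu> n)) B"
proof -
  interpret prob_space "\<nu> n" using prob assms(3) .
  interpret c: prob_space "completion (\<nu> n)" by (rule prob_space_completion)
  show ?thesis
  proof (cases "A \<in> sets (completion (\<nu> n))")
    case True
    then show ?thesis
      using assms sets_borel_completion[OF assms(2) prob sets_eq] by (intro c.finite_measure_mono) auto
  qed (simp add: measure_notin_sets)
qed

lemma log_rate_mono:
  assumes "A \<subseteq> B" "B \<in> completed_borel" "1 \<le> n"
  shows "log_rate \<nu> A n \<le> log_rate \<nu> B n"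
proof -
  have "elog (measure (completion (\<nu> n)) A) \<le> elog (measure (completion (\<nu> n)) B)"
    using measure_completion_mono[OF assms]
    by (auto simp: elog_def measure_le_0_iff ln_mono less_le)
  then show ?thesis unfolding log_rate_def by (intro ereal_mult_left_mono) auto
qed

lemma limsup_log_rate_mono:
  assumes "A \<subseteq> B" "B \<in> completed_borel"
  shows "limsup (log_rate \<nu> A) \<le> limsup (log_rate \<nu> B)"
  using log_rate_mono[OF assms] by (intro Limsup_mono eventually_sequentiallyI[of 1])

lemma liminf_log_rate_mono:
  assumes "A \<subseteq> B" "B \<in> completed_borel"
  shows "liminf (log_rate \<nu> A) \<le> liminf (log_rate \<nu> B)"
  using log_rate_mono[OF assms] by (intro Liminf_mono eventually_sequentiallyI[of 1])

text \<open>On the exponential scale a finite sum is as small as its largest term, because the number of terms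
  is absorbed by any factor \<open>exp (e n)\<close>.\<close>

lemma limsup_log_rate_Union_le:
  assumes "finite F" and F: "\<And>A. A \<in> F \<Longrightarrow> A \<in> sets borel \<and> limsup (log_rate \<nu> A) \<le> ereal c"
  shows "limsup (log_rate \<nu> (\<Union>F)) \<le> ereal c"
proof (rule ereal_le_epsilon2)
  fix e :: real assume e: "0 < e"
  define c1 where "c1 = c + e / 2"
  have "\<forall>\<^sub>F n in sequentially. \<forall>A\<in>F. log_rate \<nu> A n < ereal c1"
  proof (rule eventually_ball_finite[OF \<open>finite F\<close>], rule ballI)
    fix A assume "A \<in> F"
    then have "limsup (log_rate \<nu> A) < ereal c1"
      using F[of A] e by (auto simp: c1_def elim: order_le_less_trans)
    then show "\<forall>\<^sub>F n in sequentially. log_rate \<nu> A n < ereal c1" by (rule Limsup_lessD)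
  qed
  moreover have "\<forall>\<^sub>F n in sequentially. real (card F) \<le> exp (e / 2 * real n)"
    using e by real_asymp
  ultimately have "\<forall>\<^sub>F n in sequentially. log_rate \<nu> (\<Union>F) n \<le> ereal (c + e)"
    using eventually_ge_at_top[of 1]
  proof eventually_elim
    case (elim n)
    interpret prob_space "\<nu> n" using prob elim by blast
    have ev: "A \<in> events" if "A \<in> F" for A using F that sets_eq elim by auto
    then have "\<Union>F \<in> events" using \<open>finite F\<close> by (intro sets.finite_Union) auto
    then have "measure (completion (\<nu> n)) (\<Union>F) = prob (\<Union>A\<in>F. A)" by simp
    also have "\<dots> \<le> (\<Sum>A\<in>F. prob A)"
      using ev \<open>finite F\<close> by (intro finite_measure_subadditive_finite) auto
    also have "\<dots> \<le> (\<Sum>A\<in>F. exp (c1 * n))"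
    proof (rule sum_mono)
      fix A assume A: "A \<in> F"
      have "measure (completion (\<nu> n)) A \<le> exp (c1 * n)"
        using elim A by (subst log_rate_le_iff(1)[symmetric]) (auto simp: less_imp_le)
      then show "prob A \<le> exp (c1 * n)" using ev[OF A] by simp
    qed
    also have "\<dots> = real (card F) * exp (c1 * n)" by simp
    also have "\<dots> \<le> exp (e / 2 * n) * exp (c1 * n)" using elim by (intro mult_right_mono) auto
    also have "\<dots> = exp ((c + e) * n)" by (simp add: c1_def field_simps flip: exp_add)
    finally show ?case using elim by (simp add: log_rate_le_iff(1))
  qed
  then show "limsup (log_rate \<nu> (\<Union>F)) \<le> ereal c + ereal e"
    by (simp add: Limsup_bounded)
qed

end

section \<open>From countably many balls to all sets\<close>

lemma dense_cball_nhd: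
  fixes D :: "'y::metric_space set"
  assumes D: "closure D = UNIV" and "open U" "x \<in> U"
  obtains y r s where "y \<in> D" "0 < r" "r < s" "dist y x < r" "cball y s \<subseteq> U" "r \<in> \<rat>" "s \<in> \<rat>"
proof -
  obtain e where e: "e > 0" "ball x e \<subseteq> U" using assms open_contains_ball by blast
  obtain r where r: "r \<in> \<rat>" "0 < r" "r < e/4" using Rats_dense_in_real[of 0 "e/4"] e by auto
  obtain s where s: "s \<in> \<rat>" "r < s" "s < e/4" using Rats_dense_in_real[of r "e/4"] r by auto
  obtain y where y: "y \<in> D" "dist y x < r" using D r by (metis UNIV_I closure_approachable)
  have "cball y s \<subseteq> U"
  proof
    fix z assume "z \<in> cball y s"
    then have "dist x z < e"
      using y s r dist_triangle2[of x z y] by (simp add: dist_commute)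
    then show "z \<in> U" using e by auto
  qed
  then show ?thesis using that y r s by auto
qed

context borel_prob_sequence
begin

text \<open>For \<open>c < Inf I\<close> over \<open>K\<close>, lower semicontinuity puts around each point of \<open>K\<close> one of the given balls on
  which \<open>I\<close> still exceeds \<open>c\<close>; finitely many of them cover \<open>K\<close>.\<close>

lemma limsup_log_rate_compact:
  assumes D: "closure D = UNIV" and "lsc I" and "compact K"
    and balls: "\<And>y r. y \<in> D \<Longrightarrow> r \<in> \<rat> \<Longrightarrow> 0 < r \<Longrightarrow>
      limsup (log_rate \<nu> (cball y r)) \<le> - (INF x \<in> cball y r. I x)"
  shows "limsup (log_rate \<nu> K) \<le> - (INF x \<in> K. I x)"
proof (rule ereal_le_uminusI)
  fix c :: real assume c: "ereal c < (INF x \<in> K. I x)"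
  have "\<exists>y r. x \<in> ball y r \<and> limsup (log_rate \<nu> (cball y r)) \<le> ereal (- c)" if "x \<in> K" for x
  proof -
    have "ereal c < I x" using c that by (meson INF_lower less_le_trans)
    then have "\<forall>\<^sub>F y in nhds x. ereal c < I y" using \<open>lsc I\<close> by (simp add: lsc_def)
    then obtain U where U: "open U" "x \<in> U" "\<And>y. y \<in> U \<Longrightarrow> ereal c < I y"
      by (auto simp: eventually_nhds)
    obtain y r s where y: "y \<in> D" "0 < r" "r < s" "dist y x < r" "cball y s \<subseteq> U" "s \<in> \<rat>"
      using dense_cball_nhd[OF D U(1,2)] by metis
    have "ereal c \<le> (INF x \<in> cball y s. I x)"
      using U(3) y(5) by (intro INF_greatest) (blast intro: less_imp_le)
    then have "limsup (log_rate \<nu> (cball y s)) \<le> - ereal c"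
      using balls[of y s] y by (meson ereal_minus_le_minus order_less_trans order_trans)
    then show ?thesis using y by (intro exI[of _ y] exI[of _ s]) auto
  qed
  then obtain y r where yr: "\<And>x. x \<in> K \<Longrightarrow> x \<in> ball (y x) (r x)"
      "\<And>x. x \<in> K \<Longrightarrow> limsup (log_rate \<nu> (cball (y x) (r x))) \<le> ereal (- c)"
    by metis
  have "K \<subseteq> (\<Union>x\<in>K. ball (y x) (r x))" using yr(1) by blast
  then obtain K' where K': "K' \<subseteq> K" "finite K'" "K \<subseteq> (\<Union>x\<in>K'. ball (y x) (r x))"
    by (rule compactE_image[OF \<open>compact K\<close> open_ball])
  let ?F = "(\<lambda>x. cball (y x) (r x)) ` K'"
  have "limsup (log_rate \<nu> K) \<le> limsup (log_rate \<nu> (\<Union>?F))"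
  proof (rule limsup_log_rate_mono)
    show "K \<subseteq> \<Union>?F" by (rule order_trans[OF K'(3) UN_mono[OF order_refl ball_subset_cball]])
    have "\<Union>?F \<in> sets borel" using K'(2) by (intro borel_closed closed_UN) auto
    then show "\<Union>?F \<in> completed_borel" using borel_subset_completed_borel by blast
  qed
  also have "\<dots> \<le> ereal (- c)"
    using K' yr(2) by (intro limsup_log_rate_Union_le) auto
  finally show "limsup (log_rate \<nu> K) \<le> - ereal c" by simp
qed

text \<open>Cover \<open>\<Gamma>\<close> by the compact set \<open>closure \<Gamma> \<inter> K\<close> and the exponentially negligible set \<open>- K\<close>.\<close>

lemma limsup_log_rate_exponentially_tight:
  assumes compact: "\<And>K. compact K \<Longrightarrow> limsup (log_rate \<nu> K) \<le> - (INF x \<in> K. I x)"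
    and "exponentially_tight \<nu>"
  shows "limsup (log_rate \<nu> \<Gamma>) \<le> - (INF x \<in> closure \<Gamma>. I x)"
proof (rule ereal_le_uminusI)
  fix c :: real assume c: "ereal c < (INF x \<in> closure \<Gamma>. I x)"
  obtain K where K: "compact K" "limsup (log_rate \<nu> (- K)) \<le> - ereal c"
    using \<open>exponentially_tight \<nu>\<close> by (auto simp: exponentially_tight_def)
  let ?C = "closure \<Gamma> \<inter> K"
  have C: "compact ?C" using K(1) by (simp add: closed_Int_compact)
  have "(INF x \<in> closure \<Gamma>. I x) \<le> (INF x \<in> ?C. I x)" by (intro INF_superset_mono) auto
  then have "- (INF x \<in> ?C. I x) \<le> - ereal c" 
    using c by (meson ereal_minus_le_minus less_imp_le order_trans)
  then have C2: "limsup (log_rate \<nu> ?C) \<le> - ereal c" using compact[OF C] by order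
  have sets: "?C \<in> sets borel" "- K \<in> sets borel"
    using borel_compact[OF C] borel_comp[OF borel_compact[OF K(1)]] by auto
  have "limsup (log_rate \<nu> \<Gamma>) \<le> limsup (log_rate \<nu> (\<Union>{?C, - K}))"
  proof (rule limsup_log_rate_mono)
    show "\<Gamma> \<subseteq> \<Union>{?C, - K}" using closure_subset[of \<Gamma>] by blast
    have "?C \<union> - K \<in> sets borel" using sets by (rule sets.Un)
    then show "\<Union>{?C, - K} \<in> completed_borel" using borel_subset_completed_borel by auto
  qed
  also have "\<dots> \<le> ereal (- c)"
  proof (rule limsup_log_rate_Union_le)
    fix A assume "A \<in> {?C, - K}"
    then show "A \<in> sets borel \<and> limsup (log_rate \<nu> A) \<le> ereal (- c)"
      using sets C2 K(2) by auto
  qed simp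
  finally show "limsup (log_rate \<nu> \<Gamma>) \<le> - ereal c" by simp
qed

text \<open>Only points of finite rate matter, and these have rate below \<open>b\<close>; the bound \<open>b\<close> will be the
  exponential growth rate of the sample size. The ball of radius \<open>r\<close> carries the small value of \<open>I\<close> and the larger
  one of radius \<open>s\<close> is the one that is estimated: the gap between them leaves room for an
  approximation error.\<close>

lemma LDP_lower_from_balls:
  assumes D: "closure D = UNIV"
    and balls: "\<And>y r s c. y \<in> D \<Longrightarrow> r \<in> \<rat> \<Longrightarrow> s \<in> \<rat> \<Longrightarrow> 0 < r \<Longrightarrow> r < s \<Longrightarrow> c \<in> \<rat> \<Longrightarrow>
      \<exists>x \<in> ball y r. I x < ereal c \<and> ereal c < b \<Longrightarrow> - ereal c \<le> liminf (log_rate \<nu> (ball y s))"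
    and below: "\<And>x. I x < \<infinity> \<Longrightarrow> I x < b"
  shows "LDP_lower \<nu> I"
  unfolding LDP_lower_def
proof (rule ballI, rule ereal_uminus_leI)
  fix \<Gamma> :: "'y set" and c :: real
  assume \<Gamma>: "\<Gamma> \<in> completed_borel" and "(INF x \<in> interior \<Gamma>. I x) < ereal c"
  then obtain x where x: "x \<in> interior \<Gamma>" "I x < ereal c" by (auto simp: INF_less_iff)
  \<comment> \<open>The balls are available for rational constants only, so a rational \<open>q\<close> is placed between \<open>I x\<close> and the minimum of \<open>c\<close> and \<open>b\<close>.\<close>
  have "I x < min (ereal c) b" using x below[of x] less_trans[of "I x" "ereal c" \<infinity>] by simp
  then obtain d where d: "I x < ereal d" "ereal d < min (ereal c) b" using ereal_dense2 by blast
  then obtain d' where d': "I x < ereal d'" "d' < d" using ereal_dense2[OF d(1)] by auto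
  obtain q where q: "q \<in> \<rat>" "d' < q" "q < d" using Rats_dense_in_real[OF d'(2)] by auto
  have q2: "I x < ereal q" "ereal q < b" "q < c"
    using d d' q less_trans[of "I x" "ereal d'" "ereal q"] less_trans[of "ereal q" "ereal d" b]
    by auto
  obtain y r s where y: "y \<in> D" "0 < r" "r < s" "dist y x < r" "cball y s \<subseteq> interior \<Gamma>" "r \<in> \<rat>" "s \<in> \<rat>"
    using dense_cball_nhd[OF D open_interior x(1)] by metis
  have "- ereal q \<le> liminf (log_rate \<nu> (ball y s))"
    using y q q2 by (intro balls) auto
  also have "\<dots> \<le> liminf (log_rate \<nu> \<Gamma>)"
    using \<Gamma> y(5) interior_subset[of \<Gamma>] ball_subset_cball[of y s]
    by (intro liminf_log_rate_mono) blast+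
  finally show "- ereal c \<le> liminf (log_rate \<nu> \<Gamma>)"
    using q2(3) by (meson ereal_less_eq(3) ereal_minus_le_minus less_imp_le order_trans)
qed

end

text \<open>By the lower bound on the open set \<open>- K\<close>, the rate is at least \<open>c + 1\<close> off a compact set \<open>K\<close> whose
  complement has exponential rate at most \<open>- (c + 1)\<close>. Hence the level set at \<open>c\<close> is a closed subset of \<open>K\<close>.\<close>

lemma exponentially_tight_imp_good_rate_function:
  fixes I :: "'y::real_normed_vector \<Rightarrow> ereal"
  assumes "rate_function I" "LDP_lower \<mu> I" "exponentially_tight \<mu>"
  shows "good_rate_function I"
  unfolding good_rate_function_def
proof (intro conjI allI impI)
  fix c :: real
  obtain K where K: "compact K" "limsup (log_rate \<mu> (- K)) \<le> - ereal (c + 1)"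
    using assms(3) unfolding exponentially_tight_def by blast
  have K': "open (- K)" using K(1) compact_imp_closed by blast
  then have "- K \<in> completed_borel" using borel_subset_completed_borel by (auto intro: borel_open)
  then have "- (INF x \<in> - K. I x) \<le> liminf (log_rate \<mu> (- K))"
    using assms(2) K' unfolding LDP_lower_def by (metis interior_open)
  also have "\<dots> \<le> limsup (log_rate \<mu> (- K))" by (simp add: Liminf_le_Limsup)
  also note K(2)
  finally have INF: "ereal (c + 1) \<le> (INF x \<in> - K. I x)" using ereal_minus_le_minus by blast
  have "{x. I x \<le> ereal c} \<subseteq> K"
  proof
    fix x assume "x \<in> {x. I x \<le> ereal c}"
    then have "\<not> ereal (c + 1) \<le> I x" using order_trans by fastforce
    then show "x \<in> K" using INF by (meson ComplI INF_lower order_trans)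
  qed
  moreover have "closed {x. I x \<le> ereal c}"
  proof -
    have "open {x. ereal c < I x}"
    proof (rule iffD2[OF open_subopen], safe)
      fix x assume "ereal c < I x"
      then have "\<forall>\<^sub>F y in nhds x. ereal c < I y"
        using assms(1) unfolding rate_function_def lsc_def by blast
      then show "\<exists>T. open T \<and> x \<in> T \<and> T \<subseteq> {x. ereal c < I x}"
        unfolding eventually_nhds by blast
    qed
    moreover have "- {x. I x \<le> ereal c} = {x. ereal c < I x}" by auto
    ultimately show ?thesis by (simp add: closed_def)
  qed
  ultimately show "compact {x. I x \<le> ereal c}"
    using K(1) closed_Int_compact[of "{x. I x \<le> ereal c}" K] by (metis inf.absorb1)
next
  show "rate_function I" by (rule assms(1))
qed

section \<open>Probabilistic tools\<close>

context prob_space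
begin

text \<open>The form of the Borel--Cantelli lemma in which all almost sure statements below are obtained.\<close>

lemma AE_eventually_not_if_exponential:
  assumes A: "\<And>n. A n \<in> events" and e: "0 < e"
    and le: "\<forall>\<^sub>F n in sequentially. prob (A n) \<le> C * exp (- e * real n)"
  shows "AE \<omega> in M. \<forall>\<^sub>F n in sequentially. \<omega> \<notin> A n"
proof -
  have "summable (\<lambda>n. C * exp (- e) ^ n)"
    using e by (intro summable_mult summable_geometric) simp
  moreover have "(\<lambda>n. exp (- e) ^ n) = (\<lambda>n. exp (- e * real n))"
    by (simp add: fun_eq_iff mult.commute flip: exp_of_nat_mult)
  ultimately have "summable (\<lambda>n. C * exp (- e * real n))" by simp
  then have "summable (\<lambda>n. prob (A n))"
    by (rule summable_comparison_test_ev[rotated]) (use le in simp)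
  then have "AE \<omega> in M. \<forall>\<^sub>F n in sequentially. \<omega> \<in> space M - A n"
    using A by (intro borel_cantelli_AE1) (auto simp: less_top[symmetric])
  then show ?thesis by (auto elim: eventually_mono)
qed

text \<open>Chebyshev's inequality for the number of events that occur. For each \<open>i\<close> there are at most \<open>2 L\<close> indices \<open>j\<close> at
  distance less than \<open>L\<close>; their covariances are at most \<open>p\<close>, all others are at most \<open>a\<close>. So the variance is
  at most \<open>N (2 L p + N a)\<close>, to be divided by \<open>(N p / 2)\<^sup>2\<close>.\<close>

lemma prob_few_occurrences_le:
  assumes A: "\<And>j. j \<in> {1..N} \<Longrightarrow> A j \<in> events" "\<And>j. j \<in> {1..N} \<Longrightarrow> prob (A j) = p"
    and "0 < p" "1 \<le> N" "0 \<le> a"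
    and far: "\<And>i j. i \<in> {1..N} \<Longrightarrow> j \<in> {1..N} \<Longrightarrow> i + L \<le> j \<Longrightarrow>
      \<bar>prob (A i) * prob (A j) - prob (A i \<inter> A j)\<bar> \<le> a"
  shows "prob {\<omega> \<in> space M. (\<Sum>j=1..N. indicator (A j) \<omega>) \<le> real N * p / 2}
    \<le> 8 * real L / (real N * p) + 4 * a / p\<^sup>2"
proof -
  let ?J = "{1..N}"
  define Z where "Z \<omega> = (\<Sum>j\<in>?J. indicator (A j) \<omega> - p)" for \<omega>
  have [measurable]: "A j \<in> events" if "j \<in> ?J" for j using A that by blast
  define g where "g i j \<omega> = indicator (A i \<inter> A j) \<omega> - p * indicator (A i) \<omega>
      - p * indicator (A j) \<omega> + p\<^sup>2" for i j \<omega>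
  have Z2: "(Z \<omega>)\<^sup>2 = (\<Sum>i\<in>?J. \<Sum>j\<in>?J. g i j \<omega>)" for \<omega>
    unfolding Z_def power2_eq_square sum_product g_def
    by (intro sum.cong) (auto simp: indicator_inter_arith algebra_simps)
  have int_g: "integrable M (g i j)" if "i \<in> ?J" "j \<in> ?J" for i j
    using that unfolding g_def
    by (intro Bochner_Integration.integrable_add Bochner_Integration.integrable_diff
        integrable_mult_right integrable_real_indicator) (auto simp: less_top[symmetric])
  have exp_g: "expectation (g i j) = prob (A i \<inter> A j) - p * prob (A i) - p * prob (A j) + p\<^sup>2"
    if "i \<in> ?J" "j \<in> ?J" for i j
    using that unfolding g_def by (simp add: less_top[symmetric] prob_space)
  have int: "integrable M (\<lambda>\<omega>. (Z \<omega>)\<^sup>2)"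
    unfolding Z2 using int_g by (intro Bochner_Integration.integrable_sum)
  have "expectation (\<lambda>\<omega>. (Z \<omega>)\<^sup>2) = (\<Sum>i\<in>?J. expectation (\<lambda>\<omega>. \<Sum>j\<in>?J. g i j \<omega>))"
    unfolding Z2 using int_g
    by (intro Bochner_Integration.integral_sum Bochner_Integration.integrable_sum)
  also have "\<dots> = (\<Sum>i\<in>?J. \<Sum>j\<in>?J. expectation (g i j))"
    using int_g by (intro sum.cong refl Bochner_Integration.integral_sum)
  also have "\<dots> = (\<Sum>i\<in>?J. \<Sum>j\<in>?J. prob (A i \<inter> A j) - p\<^sup>2)"
    using A(2) by (intro sum.cong refl) (simp add: exp_g power2_eq_square)
  also have "\<dots> \<le> (\<Sum>i\<in>?J. \<Sum>j\<in>?J. (if j \<in> {i - L..<i + L} then p else 0) + a)"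
  proof (intro sum_mono)
    fix i j assume ij: "i \<in> ?J" "j \<in> ?J"
    show "prob (A i \<inter> A j) - p\<^sup>2 \<le> (if j \<in> {i - L..<i + L} then p else 0) + a"
    proof (cases "j \<in> {i - L..<i + L}")
      case True
      have "prob (A i \<inter> A j) \<le> prob (A i)" using A ij by (intro finite_measure_mono) auto
      moreover have "prob (A i) = p" using A ij by blast
      ultimately show ?thesis
        using True \<open>0 \<le> a\<close> zero_le_power2[of p] by (simp only: if_True)
    next
      case False
      then have "i + L \<le> j \<or> j + L \<le> i" by auto
      then have "\<bar>p * p - prob (A i \<inter> A j)\<bar> \<le> a"
        using far[of i j] far[of j i] A(2) ij by (auto simp: Int_commute)
      then show ?thesis unfolding power2_eq_square if_not_P[OF False] by linarith
    qed
  qed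
  also have "\<dots> = (\<Sum>i\<in>?J. real (card (?J \<inter> {i - L..<i + L})) * p + N * a)"
    by (simp add: sum.distrib sum.If_cases Int_def)
  also have "\<dots> \<le> (\<Sum>i\<in>?J. real (2 * L) * p + N * a)"
  proof (intro sum_mono add_right_mono mult_right_mono of_nat_mono)
    fix i
    have "card (?J \<inter> {i - L..<i + L}) \<le> card {i - L..<i + L}" by (intro card_mono) auto
    also have "\<dots> \<le> 2 * L" by simp
    finally show "card (?J \<inter> {i - L..<i + L}) \<le> 2 * L" .
  qed (use \<open>0 < p\<close> in auto)
  also have "\<dots> = N * (2 * L * p + N * a)" by simp
  finally have exp_le: "expectation (\<lambda>\<omega>. (Z \<omega>)\<^sup>2) \<le> N * (2 * L * p + N * a)" .
  have Np: "0 < real N * p / 2" using assms by simp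
  have "prob {\<omega> \<in> space M. (\<Sum>j\<in>?J. indicator (A j) \<omega>) \<le> real N * p / 2}
      \<le> prob {\<omega> \<in> space M. (real N * p / 2)\<^sup>2 \<le> (Z \<omega>)\<^sup>2}"
  proof (rule finite_measure_mono)
    show "{\<omega> \<in> space M. (\<Sum>j\<in>?J. indicator (A j) \<omega>) \<le> real N * p / 2}
        \<subseteq> {\<omega> \<in> space M. (real N * p / 2)\<^sup>2 \<le> (Z \<omega>)\<^sup>2}"
    proof safe
      fix \<omega> assume "(\<Sum>j\<in>?J. indicator (A j) \<omega>) \<le> real N * p / 2"
      then have "real N * p / 2 \<le> - Z \<omega>" by (simp add: Z_def sum_subtractf mult.commute)
      then show "(real N * p / 2)\<^sup>2 \<le> (Z \<omega>)\<^sup>2"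
        using Np by (metis less_imp_le power2_minus power_mono)
    qed
    have "Z \<in> borel_measurable M" unfolding Z_def by measurable
    then show "{\<omega> \<in> space M. (real N * p / 2)\<^sup>2 \<le> (Z \<omega>)\<^sup>2} \<in> events" by measurable
  qed
  also have "\<dots> \<le> expectation (\<lambda>\<omega>. (Z \<omega>)\<^sup>2) / (real N * p / 2)\<^sup>2"
    using int \<open>0 < p\<close> \<open>1 \<le> N\<close> by (intro integral_Markov_inequality_measure[where A = "{}"]) auto
  also have "\<dots> \<le> N * (2 * L * p + N * a) / (real N * p / 2)\<^sup>2"
    using exp_le by (intro divide_right_mono) auto
  also have "\<dots> = 8 * real L / (real N * p) + 4 * a / p\<^sup>2"
    using assms by (simp add: field_simps power2_eq_square)
  finally show ?thesis .
qed

end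

section \<open>Mixing\<close>

lemma sigma_proc_mono: "J \<subseteq> J' \<Longrightarrow> sigma_proc M E X J \<subseteq> sigma_proc M E X J'"
  unfolding sigma_proc_def by (intro sigma_sets_mono') auto

locale measurable_process = prob_space M for M :: "'a measure" +
  fixes E :: "'e measure" and X :: "nat \<Rightarrow> 'a \<Rightarrow> 'e"
  assumes X_measurable: "1 \<le> i \<Longrightarrow> X i \<in> measurable M E"
begin

lemma sigma_proc_subset_events:
  assumes "J \<subseteq> {1..}"
  shows "sigma_proc M E X J \<subseteq> events"
  unfolding sigma_proc_def
  using assms X_measurable by (intro sets.sigma_sets_subset) (auto intro!: measurable_sets)

lemma abs_covariance_le_1: "\<bar>prob A * prob B - prob (A \<inter> B)\<bar> \<le> 1"
  by (smt (verit) measure_nonneg mult_le_one mult_nonneg_nonneg prob_le_1)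

lemma alpha_coeff_bounds:
  assumes "A \<in> U" "B \<in> V"
  shows "\<bar>prob A * prob B - prob (A \<inter> B)\<bar> \<le> alpha_coeff M U V" "0 \<le> alpha_coeff M U V"
    "alpha_coeff M U V \<le> 1"
proof -
  let ?f = "\<lambda>(A, B). \<bar>prob A * prob B - prob (A \<inter> B)\<bar>"
  have "bdd_above (?f ` (U \<times> V))"
    using abs_covariance_le_1 by (intro bdd_aboveI[of _ 1]) auto
  then have "?f (A, B) \<le> alpha_coeff M U V"
    unfolding alpha_coeff_def using assms by (intro cSUP_upper) auto
  then show "\<bar>prob A * prob B - prob (A \<inter> B)\<bar> \<le> alpha_coeff M U V" by simp
  then show "0 \<le> alpha_coeff M U V" by (rule order_trans[OF abs_ge_zero])
  show "alpha_coeff M U V \<le> 1"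
    unfolding alpha_coeff_def using assms abs_covariance_le_1 by (intro cSUP_least) auto
qed

lemma empty_in_sigma_proc: "{} \<in> sigma_proc M E X J"
  unfolding sigma_proc_def by (rule sigma_sets.Empty)

lemma alpha_coeff_le_alpha_mix:
  assumes "1 \<le> i" "1 \<le> m"
  shows "alpha_coeff M (sigma_proc M E X {1..i}) (sigma_proc M E X {i + m..}) \<le> alpha_mix M E X m"
  unfolding alpha_mix_def using assms alpha_coeff_bounds(3)[OF empty_in_sigma_proc empty_in_sigma_proc]
  by (auto intro!: cSUP_upper bdd_aboveI[of _ 1])

lemma covariance_le_alpha_mix:
  assumes "A \<in> sigma_proc M E X {1..i}" "B \<in> sigma_proc M E X {i + m..}" "1 \<le> i" "1 \<le> m"
  shows "\<bar>prob A * prob B - prob (A \<inter> B)\<bar> \<le> alpha_mix M E X m"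
  using alpha_coeff_bounds(1)[OF assms(1,2)] alpha_coeff_le_alpha_mix[OF assms(3,4)] by linarith

lemma alpha_mix_le_1: "alpha_mix M E X m \<le> 1"
  unfolding alpha_mix_def
  using alpha_coeff_bounds(3)[OF empty_in_sigma_proc empty_in_sigma_proc]
  by (auto intro!: cSUP_least)

lemma alpha_mix_nonneg: "0 \<le> alpha_mix M E X m"
proof (cases "m = 0")
  case False
  then show ?thesis
    using covariance_le_alpha_mix[OF empty_in_sigma_proc empty_in_sigma_proc, of 1 m] by simp
qed (simp add: alpha_mix_def)

lemma alpha_mix_antimono:
  assumes "1 \<le> m" "m \<le> m'"
  shows "alpha_mix M E X m' \<le> alpha_mix M E X m"
proof -
  have "alpha_coeff M (sigma_proc M E X {1..i}) (sigma_proc M E X {i + m'..}) \<le> alpha_mix M E X m"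
    if "1 \<le> i" for i
    unfolding alpha_coeff_def
  proof (rule cSUP_least, use empty_in_sigma_proc in blast, safe)
    fix A B assume "A \<in> sigma_proc M E X {1..i}" "B \<in> sigma_proc M E X {i + m'..}"
    then show "\<bar>prob A * prob B - prob (A \<inter> B)\<bar> \<le> alpha_mix M E X m"
      using assms that sigma_proc_mono[of "{i + m'..}" "{i + m..}" M E X]
      by (intro covariance_le_alpha_mix[of _ i]) auto
  qed
  then show ?thesis
    using assms unfolding alpha_mix_def[of M E X m'] by (auto intro!: cSUP_least)
qed

text \<open>The halving takes care of \<open>m = 0\<close>, where the mixing coefficient is \<open>1/2\<close> by convention: since all
  coefficients are at most \<open>1\<close>, such a \<open>u\<close> stays below \<open>1/2\<close>.\<close>

lemma alpha_inv_ge: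
  assumes "1 \<le> m" "u < alpha_mix M E X m / 2"
  shows "of_nat m \<le> alpha_inv M E X u"
  unfolding alpha_inv_def
proof (rule INF_greatest, safe)
  fix m' assume u: "alpha_mix M E X m' \<le> u"
  have "m' \<noteq> 0"
  proof
    assume "m' = 0"
    then have "1 / 2 \<le> u" using u by (simp add: alpha_mix_def)
    then show False using assms alpha_mix_le_1[of m] by simp
  qed
  have "m \<le> m'"
  proof (rule ccontr)
    assume "\<not> m \<le> m'"
    then have "alpha_mix M E X m \<le> alpha_mix M E X m'"
      using \<open>m' \<noteq> 0\<close> by (intro alpha_mix_antimono) auto
    then show False using u assms alpha_mix_nonneg[of m] by simp
  qed
  then show "(of_nat m :: ennreal) \<le> of_nat m'" by simp
qed

text \<open>On the interval \<open>[0, \<alpha>\<^sub>m / 2)\<close> the inverse mixing function is at least \<open>m\<close>, so the \<open>h\<close>-th moment is at least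
  \<open>m\<^sup>h \<alpha>\<^sub>m / 2\<close>.\<close>

lemma alpha_mix_polynomial_decay:
  assumes "0 < h" and fin: "mixing_moment M E X h < \<infinity>"
  obtains C where "0 \<le> C" "\<And>m. 1 \<le> m \<Longrightarrow> alpha_mix M E X m \<le> C * real m powr (- h)"
proof
  define C where "C = 2 * enn2real (mixing_moment M E X h)"
  show "0 \<le> C" by (simp add: C_def)
  fix m :: nat assume m: "1 \<le> m"
  define a where "a = alpha_mix M E X m"
  have a: "0 \<le> a" "a \<le> 1" using alpha_mix_nonneg alpha_mix_le_1 by (auto simp: a_def)
  have powr_le: "ennreal (real m powr h) \<le> ennreal_powr (alpha_inv M E X u) h" if "u < a / 2" for u
  proof (cases "alpha_inv M E X u = \<infinity>")
    case False
    have "of_nat m \<le> alpha_inv M E X u" using alpha_inv_ge m that by (simp add: a_def)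
    then have "real m \<le> enn2real (alpha_inv M E X u)"
      using False enn2real_mono[of "of_nat m" "alpha_inv M E X u"] by (simp add: less_top)
    then show ?thesis
      using False \<open>0 < h\<close> m by (auto simp: ennreal_powr_def intro!: ennreal_leI powr_mono2)
  qed (simp add: ennreal_powr_def)
  have "ennreal (real m powr h * (a / 2)) = (\<integral>\<^sup>+ u. ennreal (real m powr h) * indicator {0..<a / 2} u \<partial>lborel)"
    using a by (subst nn_integral_cmult_indicator) (auto simp flip: ennreal_mult)
  also have "\<dots> \<le> mixing_moment M E X h"
    unfolding mixing_moment_def using a powr_le
    by (intro nn_integral_mono) (auto simp: indicator_def)
  finally have "real m powr h * (a / 2) \<le> enn2real (mixing_moment M E X h)"
    using fin a by (metis enn2real_ennreal enn2real_mono divide_nonneg_pos infinity_ennreal_def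
      mult_nonneg_nonneg powr_ge_zero zero_less_numeral)
  then show "alpha_mix M E X m \<le> C * real m powr (- h)"
    using m by (simp add: C_def a_def powr_minus field_simps)
qed

end

section \<open>Observations along a stationary process\<close>

lemma prob_space_empirical_measure:
  assumes "1 \<le> N"
  shows "prob_space (empirical_measure N x)"
proof (intro prob_spaceI)
  have "(of_nat N :: ennreal) / of_nat N = 1"
    using assms by (intro ennreal_divide_self) (auto simp: of_nat_less_top)
  then show "emeasure (empirical_measure N x) (space (empirical_measure N x)) = 1"
    by (simp add: emeasure_empirical_measure)
qed

lemma measure_empirical_measure:
  assumes "A \<in> sets borel" "1 \<le> N"
  shows "measure (empirical_measure N x) A = (\<Sum>j=1..N. indicator A (x j)) / real N"
proof -
  have "emeasure (empirical_measure N x) A = ennreal ((\<Sum>j=1..N. indicator A (x j)) / real N)"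
    using assms
    by (simp add: emeasure_empirical_measure divide_ennreal[symmetric] sum_nonneg ennreal_of_nat_eq_real_of_nat
      flip: sum_ennreal ennreal_indicator)
  then show ?thesis by (simp add: measure_def sum_nonneg)
qed

lemma measurable_shift: "shift \<in> measurable (seq_space E) (seq_space E)"
  unfolding shift_def by (intro measurable_restrict measurable_component_singleton) auto

lemma measurable_funpow_shift: "(shift ^^ m) \<in> measurable (seq_space E) (seq_space E)"
proof (induction m)
  case (Suc m)
  then show ?case using measurable_comp[OF Suc measurable_shift] by (simp only: funpow.simps)
qed (simp add: id_def)

locale stationary_observations = measurable_process M E X
  for M :: "'a measure" and E :: "'e measure" and X :: "nat \<Rightarrow> 'a \<Rightarrow> 'e" +
  fixes S :: "nat \<Rightarrow> (nat \<Rightarrow> 'e) \<Rightarrow> 'y::real_normed_vector" and k :: "nat \<Rightarrow> nat"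
  assumes stationary: "stationary_process M E X"
    and S_measurable: "1 \<le> n \<Longrightarrow> S n \<in> measurable (seq_space E) borel"
    and k_pos: "1 \<le> n \<Longrightarrow> 1 \<le> k n"
begin

abbreviation empirical :: "'a \<Rightarrow> nat \<Rightarrow> 'y measure" where
  "empirical \<omega> n \<equiv> empirical_measure (k n) (sample X S \<omega> n)"

lemma borel_prob_sequence_empirical: "borel_prob_sequence (empirical \<omega>)"
  by (rule borel_prob_sequence.intro) (rule prob_space_empirical_measure, erule k_pos, simp)

lemma measurable_path: "path X \<in> measurable M (seq_space E)"
  unfolding path_def by (intro measurable_restrict X_measurable) auto

lemma distr_shifted_path:
  "distr M (seq_space E) (\<lambda>\<omega>. (shift ^^ m) (path X \<omega>)) = distr M (seq_space E) (path X)"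
proof (induction m)
  case (Suc m)
  have "distr M (seq_space E) (\<lambda>\<omega>. (shift ^^ Suc m) (path X \<omega>))
      = distr (distr M (seq_space E) (\<lambda>\<omega>. (shift ^^ m) (path X \<omega>))) (seq_space E) shift"
    using measurable_compose[OF measurable_path measurable_funpow_shift] measurable_shift
    by (subst distr_distr) (auto simp: comp_def)
  also have "\<dots> = distr (distr M (seq_space E) (path X)) (seq_space E) shift" by (simp only: Suc)
  also have "\<dots> = distr M (seq_space E) (\<lambda>\<omega>. shift (path X \<omega>))"
    using measurable_path measurable_shift by (subst distr_distr) (auto simp: comp_def)
  also have "\<dots> = distr M (seq_space E) (path X)" using stationary by (simp add: stationary_process_def)
  finally show ?case .
qed simp

lemma prob_shifted_path:
  assumes [measurable]: "f \<in> measurable (seq_space E) borel" "B \<in> sets borel"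
  shows "{\<omega> \<in> space M. f ((shift ^^ m) (path X \<omega>)) \<in> B} \<in> events"
    and "prob {\<omega> \<in> space M. f ((shift ^^ m) (path X \<omega>)) \<in> B} = prob {\<omega> \<in> space M. f (path X \<omega>) \<in> B}"
proof -
  have [measurable]: "(\<lambda>\<omega>. (shift ^^ i) (path X \<omega>)) \<in> measurable M (seq_space E)" for i
    by (rule measurable_compose[OF measurable_path measurable_funpow_shift])
  show "{\<omega> \<in> space M. f ((shift ^^ m) (path X \<omega>)) \<in> B} \<in> events" by measurable
  have *: "prob {\<omega> \<in> space M. f ((shift ^^ i) (path X \<omega>)) \<in> B}
      = measure (distr M (seq_space E) (\<lambda>\<omega>. (shift ^^ i) (path X \<omega>))) {z \<in> space (seq_space E). f z \<in> B}" for i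
  proof (subst measure_distr)
    show "{z \<in> space (seq_space E). f z \<in> B} \<in> sets (seq_space E)" by measurable
    have "(shift ^^ i) (path X \<omega>) \<in> space (seq_space E)" if "\<omega> \<in> space M" for \<omega>
      using that by (rule measurable_space[rotated]) measurable
    then show "prob {\<omega> \<in> space M. f ((shift ^^ i) (path X \<omega>)) \<in> B}
      = prob ((\<lambda>\<omega>. (shift ^^ i) (path X \<omega>)) -` {z \<in> space (seq_space E). f z \<in> B} \<inter> space M)"
      by (intro arg_cong[where f = prob]) blast
  qed measurable
  show "prob {\<omega> \<in> space M. f ((shift ^^ m) (path X \<omega>)) \<in> B} = prob {\<omega> \<in> space M. f (path X \<omega>) \<in> B}"
    using trans[OF *[of m, unfolded distr_shifted_path] *[of 0, unfolded distr_shifted_path, symmetric]]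
    unfolding funpow_0 .
qed

lemma measurable_scaled_S:
  assumes "1 \<le> n"
  shows "(\<lambda>z. S n z /\<^sub>R real n) \<in> measurable (seq_space E) borel"
  by (rule measurable_compose[OF S_measurable[OF assms]])
     (intro borel_measurable_continuous_onI continuous_intros)

lemma measure_mu_law:
  assumes "1 \<le> n" "B \<in> sets borel"
  shows "measure (mu_law M X S n) B = prob {\<omega> \<in> space M. S n (path X \<omega>) /\<^sub>R real n \<in> B}"
  unfolding mu_law_def
  using measurable_compose[OF measurable_path measurable_scaled_S] assms
  by (subst measure_distr) (auto intro!: arg_cong[where f = prob])

lemma borel_prob_sequence_mu_law: "borel_prob_sequence (mu_law M X S)"
  using measurable_compose[OF measurable_path measurable_scaled_S]
  by (intro borel_prob_sequence.intro) (auto simp: mu_law_def intro!: prob_space_distr)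

lemma
  assumes n: "1 \<le> n" and B: "B \<in> sets borel"
  shows measurable_measure_empirical: "(\<lambda>\<omega>. measure (empirical \<omega> n) B) \<in> borel_measurable M"
    and expectation_measure_empirical:
      "expectation (\<lambda>\<omega>. measure (empirical \<omega> n) B) = measure (mu_law M X S n) B"
    and integrable_measure_empirical: "integrable M (\<lambda>\<omega>. measure (empirical \<omega> n) B)"
proof -
  let ?A = "\<lambda>j. {\<omega> \<in> space M. sample X S \<omega> n j \<in> B}"
  have A: "?A j \<in> events" "prob (?A j) = measure (mu_law M X S n) B" for j
    using prob_shifted_path[OF measurable_scaled_S[OF n] B]
    by (simp_all add: sample_def measure_mu_law[OF n B])
  have eq: "measure (empirical \<omega> n) B = (\<Sum>j=1..k n. indicator (?A j) \<omega>) / real (k n)"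
    if "\<omega> \<in> space M" for \<omega>
    using that B k_pos[OF n] by (simp add: measure_empirical_measure indicator_def)
  have int: "integrable M (indicat_real (?A j))" for j
    using A by (intro integrable_real_indicator) (auto simp: less_top[symmetric])
  have int': "integrable M (\<lambda>\<omega>. (\<Sum>j=1..k n. indicat_real (?A j) \<omega>) / real (k n))"
    using int by (intro integrable_divide_zero Bochner_Integration.integrable_sum) auto
  then show "integrable M (\<lambda>\<omega>. measure (empirical \<omega> n) B)"
    by (simp add: eq cong: Bochner_Integration.integrable_cong)
  then show "(\<lambda>\<omega>. measure (empirical \<omega> n) B) \<in> borel_measurable M" by simp
  have "expectation (\<lambda>\<omega>. measure (empirical \<omega> n) B)
      = expectation (\<lambda>\<omega>. (\<Sum>j=1..k n. indicat_real (?A j) \<omega>) / real (k n))"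
    by (intro Bochner_Integration.integral_cong) (simp_all add: eq)
  also have "\<dots> = (\<Sum>j=1..k n. prob (?A j)) / real (k n)"
    using int A(1) by (simp add: Bochner_Integration.integral_sum)
  also have "\<dots> = measure (mu_law M X S n) B" using k_pos[OF n] by (simp add: A(2))
  finally show "expectation (\<lambda>\<omega>. measure (empirical \<omega> n) B) = measure (mu_law M X S n) B" .
qed

text \<open>Markov's inequality, using that the empirical mass of \<open>B\<close> has mean \<open>\<mu>\<^sub>n(B)\<close>. The comparison is made between two
  exponentials \<open>exp (c' n)\<close> and \<open>exp (c n)\<close> instead of with \<open>\<mu>\<^sub>n(B)\<close> itself, which may vanish.\<close>

lemma AE_limsup_log_rate_le:
  assumes B: "B \<in> sets borel"
  shows "AE \<omega> in M. limsup (log_rate (empirical \<omega>) B) \<le> limsup (log_rate (mu_law M X S) B)"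
proof -
  have AE_c: "AE \<omega> in M. limsup (log_rate (empirical \<omega>) B) \<le> ereal c"
    if less_c: "limsup (log_rate (mu_law M X S) B) < ereal c" for c
  proof -
    obtain c' where c': "limsup (log_rate (mu_law M X S) B) < ereal c'" "c' < c"
      using ereal_dense2[OF less_c] by auto
    \<comment> \<open>The index \<open>0\<close> is replaced by \<open>1\<close>, because the empirical mass is known to be measurable only for \<open>1 \<le> n\<close>.\<close>
    define A where "A n = {\<omega> \<in> space M. exp (c * n) \<le> measure (empirical \<omega> (max 1 n)) B}" for n
    have "AE \<omega> in M. \<forall>\<^sub>F n in sequentially. \<omega> \<notin> A n"
    proof (rule AE_eventually_not_if_exponential)
      show "A n \<in> events" for n
        unfolding A_def using measurable_measure_empirical[OF max.cobounded1 B, of n] by measurable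
      show "0 < c - c'" using c' by simp
      show "\<forall>\<^sub>F n in sequentially. prob (A n) \<le> 1 * exp (- (c - c') * n)"
        using Limsup_lessD[OF c'(1)] eventually_ge_at_top[of 1]
      proof eventually_elim
        case (elim n)
        have "measure (completion (mu_law M X S n)) B \<le> exp (c' * n)"
          using elim by (subst log_rate_le_iff(1)[symmetric]) (auto intro: less_imp_le)
        then have q: "measure (mu_law M X S n) B \<le> exp (c' * n)"
          using B elim borel_prob_sequence.sets_eq[OF borel_prob_sequence_mu_law] by simp
        have "prob (A n) \<le> expectation (\<lambda>\<omega>. measure (empirical \<omega> n) B) / exp (c * n)"
          unfolding A_def using elim(2) integrable_measure_empirical[OF elim(2) B]
          by (simp add: max.absorb2, intro integral_Markov_inequality_measure[where A = "{}"]) auto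
        also have "\<dots> \<le> exp (c' * n) / exp (c * n)"
          using q elim(2) B by (intro divide_right_mono) (simp_all add: expectation_measure_empirical)
        also have "\<dots> = 1 * exp (- (c - c') * n)" by (simp add: exp_diff[symmetric] algebra_simps)
        finally show ?case .
      qed
    qed
    then show ?thesis
      using AE_space
    proof eventually_elim
      case (elim \<omega>)
      have "\<forall>\<^sub>F n in sequentially. log_rate (empirical \<omega>) B n \<le> ereal c"
        using elim(1) eventually_ge_at_top[of 1]
      proof eventually_elim
        case (elim n)
        then have "measure (empirical \<omega> n) B \<le> exp (c * n)"
          using \<open>\<omega> \<in> space M\<close> by (auto simp: A_def max.absorb2)
        then show ?case using elim(2) B by (simp add: log_rate_le_iff(1))
      qed
      then show ?case by (rule Limsup_bounded)
    qed
  qed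
  have "AE \<omega> in M. \<forall>c\<in>\<rat>. limsup (log_rate (mu_law M X S) B) < ereal c \<longrightarrow>
      limsup (log_rate (empirical \<omega>) B) \<le> ereal c"
    using AE_c by (intro AE_ball_countable[THEN iffD2] countable_rat ballI) (auto intro: AE_impI)
  then show ?thesis
  proof eventually_elim
    case (elim \<omega>)
    show ?case
    proof (rule dense_ge)
      fix z assume "limsup (log_rate (mu_law M X S) B) < z"
      then obtain a where a: "limsup (log_rate (mu_law M X S) B) < ereal a" "ereal a < z"
        using ereal_dense2 by blast
      then obtain b where b: "ereal a < ereal b" "ereal b < z" using ereal_dense2 by blast
      then obtain c where c: "c \<in> \<rat>" "a < c" "c < b" using Rats_dense_in_real[of a b] by auto
      have "limsup (log_rate (empirical \<omega>) B) \<le> ereal c"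
        using elim c(1,2) a(1) less_trans[of _ "ereal a" "ereal c"] by auto
      then show "limsup (log_rate (empirical \<omega>) B) \<le> z"
        using c(3) b(2) by (meson ereal_less_eq(3) less_imp_le order_trans)
    qed
  qed
qed

end

section \<open>The lower bound on a ball\<close>

context measurable_process
begin

text \<open>The function \<open>f\<close> cannot tell the shifted path from the sequence that agrees with it on the window and is
  constant afterwards, and that sequence is measurable with respect to the coordinates in the window.\<close>

lemma finite_window_in_sigma_proc:
  assumes f: "f \<in> measurable (seq_space E) borel"
    and window: "\<And>z z'. z \<in> space (seq_space E) \<Longrightarrow> z' \<in> space (seq_space E) \<Longrightarrow>
      (\<forall>i\<in>{1..d}. z i = z' i) \<Longrightarrow> f z = f z'"
    and B: "B \<in> sets borel" and J: "{m + 1..m + d} \<subseteq> J" "J \<subseteq> {1..}"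
  shows "{\<omega> \<in> space M. f ((shift ^^ m) (path X \<omega>)) \<in> B} \<in> sigma_proc M E X J"
proof -
  obtain \<omega>0 where "\<omega>0 \<in> space M" using not_empty by blast
  then have e0: "X 1 \<omega>0 \<in> space E" using X_measurable[of 1] by (auto dest: measurable_space)
  define \<G> where "\<G> = (\<Union>k\<in>J. {X k -` A \<inter> space M | A. A \<in> sets E})"
  define N where "N = sigma (space M) \<G>"
  have \<G>: "\<G> \<subseteq> Pow (space M)" by (auto simp: \<G>_def)
  have space_N: "space N = space M" and sets_N: "sets N = sigma_proc M E X J"
    using \<G> by (simp_all add: N_def sigma_proc_def \<G>_def)
  have X_N: "X i \<in> measurable N E" if "i \<in> J" for i
  proof (rule measurableI)
    have "X i \<in> measurable M E" using X_measurable that J(2) by auto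
    then show "X i \<omega> \<in> space E" if "\<omega> \<in> space N" for \<omega>
      using that by (auto simp: space_N dest: measurable_space)
    show "X i -` A \<inter> space N \<in> sets N" if "A \<in> sets E" for A
      unfolding space_N sets_N sigma_proc_def using that \<open>i \<in> J\<close> by (intro sigma_sets.Basic) auto
  qed
  define g where "g \<omega> = (\<lambda>i\<in>{1..}. if i \<le> d then X (i + m) \<omega> else X 1 \<omega>0)" for \<omega>
  have g: "g \<in> measurable N (seq_space E)"
    unfolding g_def
  proof (rule measurable_restrict)
    fix i :: nat assume "i \<in> {1..}"
    then have "i \<le> d \<Longrightarrow> i + m \<in> J" using J(1) by (intro subsetD[OF J(1)]) auto
    then show "(\<lambda>\<omega>. if i \<le> d then X (i + m) \<omega> else X 1 \<omega>0) \<in> measurable N E"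
      using e0 X_N[of "i + m"] by (cases "i \<le> d") auto
  qed
  have "f (g \<omega>) = f ((shift ^^ m) (path X \<omega>))" if "\<omega> \<in> space M" for \<omega>
  proof (rule window)
    show "g \<omega> \<in> space (seq_space E)" using g that space_N by (auto dest: measurable_space)
    have "X i \<omega> \<in> space E" if "1 \<le> i" for i
      using X_measurable[OF that] \<open>\<omega> \<in> space M\<close> by (rule measurable_space)
    then show "(shift ^^ m) (path X \<omega>) \<in> space (seq_space E)"
      unfolding funpow_shift_path space_PiM by (intro restrict_PiE_iff[THEN iffD2]) simp
  qed (simp add: g_def funpow_shift_path)
  then have "{\<omega> \<in> space M. f ((shift ^^ m) (path X \<omega>)) \<in> B} = (\<lambda>\<omega>. f (g \<omega>)) -` B \<inter> space N"
    by (auto simp: space_N)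
  also have "\<dots> \<in> sets N"
    using measurable_compose[OF g f] B by (rule measurable_sets)
  finally show ?thesis by (simp add: sets_N)
qed

end

context stationary_observations
begin

lemma prob_few_visits_le:
  assumes n: "1 \<le> n" and f: "f \<in> measurable (seq_space E) borel"
    and window: "\<And>z z'. z \<in> space (seq_space E) \<Longrightarrow> z' \<in> space (seq_space E) \<Longrightarrow>
      (\<forall>i\<in>{1..2 * n}. z i = z' i) \<Longrightarrow> f z = f z'"
    and B: "B \<in> sets borel" and p: "p = prob {\<omega> \<in> space M. f (path X \<omega>) \<in> B}" "0 < p"
    and "1 \<le> N" "1 \<le> l"
  shows "{\<omega> \<in> space M. (\<Sum>j=1..N. indicator B (f ((shift ^^ ((j - 1) * n)) (path X \<omega>)))) \<le> real N * p / 2} \<in> events"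
    and "prob {\<omega> \<in> space M. (\<Sum>j=1..N. indicator B (f ((shift ^^ ((j - 1) * n)) (path X \<omega>)))) \<le> real N * p / 2}
      \<le> 8 * real (l + 1) / (real N * p) + 4 * alpha_mix M E X l / p\<^sup>2"
proof -
  define A where "A j = {\<omega> \<in> space M. f ((shift ^^ ((j - 1) * n)) (path X \<omega>)) \<in> B}" for j
  have A: "A j \<in> events" "prob (A j) = p" for j
    unfolding A_def using prob_shifted_path[OF f B] p by blast+
  have eq: "{\<omega> \<in> space M. (\<Sum>j=1..N. indicator B (f ((shift ^^ ((j - 1) * n)) (path X \<omega>)))) \<le> real N * p / 2}
      = {\<omega> \<in> space M. (\<Sum>j=1..N. indicator (A j) \<omega>) \<le> real N * p / 2}"
    by (auto simp: A_def indicator_def)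
  show "{\<omega> \<in> space M. (\<Sum>j=1..N. indicator B (f ((shift ^^ ((j - 1) * n)) (path X \<omega>)))) \<le> real N * p / 2} \<in> events"
    unfolding eq using A(1) by measurable
  show "prob {\<omega> \<in> space M. (\<Sum>j=1..N. indicator B (f ((shift ^^ ((j - 1) * n)) (path X \<omega>)))) \<le> real N * p / 2}
      \<le> 8 * real (l + 1) / (real N * p) + 4 * alpha_mix M E X l / p\<^sup>2"
    unfolding eq
  proof (rule prob_few_occurrences_le)
    fix i j assume ij: "i \<in> {1..N}" "j \<in> {1..N}" "i + (l + 1) \<le> j"
    \<comment> \<open>The distance from the end \<open>(i + 1) n\<close> of the first window to the start \<open>(j - 1) n + 1\<close> of the second.\<close>
    define gap where "gap = (j - i - 2) * n + 1"
    have j: "j = i + (j - i - 2) + 2" using ij \<open>1 \<le> l\<close> by simp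
    have start: "(i + 1) * n + gap = (j - 1) * n + 1"
      unfolding gap_def by (subst (2) j) (simp add: algebra_simps)
    have "l - 1 \<le> (j - i - 2) * n" using ij n by (intro order_trans[OF _ mult_le_mono2[OF n]]) auto
    then have gap: "l \<le> gap" by (simp add: gap_def)
    have "A i \<in> sigma_proc M E X {1..(i + 1) * n}"
    proof -
      have "(i - 1) * n + 2 * n = (i + 1) * n" using ij(1) by (cases i) (auto simp: algebra_simps)
      then show ?thesis
        unfolding A_def by (intro finite_window_in_sigma_proc[where d = "2 * n"] f window B) auto
    qed
    moreover have "A j \<in> sigma_proc M E X {(i + 1) * n + gap..}"
      unfolding start A_def
      by (intro finite_window_in_sigma_proc[where d = "2 * n"] f window B) auto
    ultimately have "\<bar>prob (A i) * prob (A j) - prob (A i \<inter> A j)\<bar> \<le> alpha_mix M E X gap"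
      by (rule covariance_le_alpha_mix) (use n in \<open>auto simp: gap_def\<close>)
    also have "\<dots> \<le> alpha_mix M E X l" using gap \<open>1 \<le> l\<close> by (intro alpha_mix_antimono)
    finally show "\<bar>prob (A i) * prob (A j) - prob (A i \<inter> A j)\<bar> \<le> alpha_mix M E X l" .
  qed (use A p \<open>1 \<le> N\<close> alpha_mix_nonneg in auto)
qed

end

text \<open>The balance of exponents in the lower bound: with \<open>l\<close> of order \<open>exp (e n)\<close> the first term is of order
  \<open>exp (e n - (d - c) n) = exp (- e n)\<close>, and the power \<open>(2 c + e) / e\<close> is the one for which the second is of order
  \<open>exp (2 c n - (2 c + e) n) = exp (- e n)\<close>.\<close>

lemma exponential_error_bound:
  fixes n :: nat and c d e p K C a :: real
  assumes "0 \<le> c" "c < d" and e: "e = (d - c) / 2" and K: "exp (d * n) \<le> K" and p: "exp (- c * n) \<le> p"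
    and "0 \<le> C" and l: "l = nat \<lceil>exp (e * n)\<rceil>"
    and a: "a \<le> C * real l powr (- ((2 * c + e) / e))"
  shows "8 * real (l + 1) / (K * p) + 4 * a / p\<^sup>2 \<le> (24 + 4 * C) * exp (- e * n)"
proof -
  have "0 < e" using assms by simp
  have E1: "1 \<le> exp (e * n)" using \<open>0 < e\<close> by simp
  have pos: "0 < p" using p by (meson exp_gt_zero less_le_trans)
  have l_ge: "exp (e * n) \<le> real l" unfolding l by (rule of_nat_ceiling)
  have "real l \<le> exp (e * n) + 1" unfolding l using E1 by linarith
  then have l_le: "real (l + 1) \<le> 3 * exp (e * n)" using E1 by linarith
  have "exp (d * n) * exp (- c * n) \<le> K * p"
    using K p by (intro mult_mono) (auto intro: order_trans[OF exp_ge_zero])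
  moreover have "exp (d * n) * exp (- c * n) = exp (2 * e * n)"
    by (simp add: e algebra_simps flip: exp_add)
  ultimately have Kp: "exp (2 * e * n) \<le> K * p" by simp
  have "8 * real (l + 1) / (K * p) \<le> 8 * (3 * exp (e * n)) / exp (2 * e * n)"
    using l_le Kp by (intro frac_le mult_left_mono) auto
  also have "\<dots> = 24 * (exp (e * n) / exp (2 * e * n))" by simp
  also have "exp (e * n) / exp (2 * e * n) = exp (- e * n)" by (simp flip: exp_diff)
  finally have first: "8 * real (l + 1) / (K * p) \<le> 24 * exp (- e * n)" .
  have "real l powr (- ((2 * c + e) / e)) \<le> exp (e * n) powr (- ((2 * c + e) / e))"
    using l_ge \<open>0 < e\<close> \<open>0 \<le> c\<close> by (intro powr_mono2') auto
  also have "\<dots> = exp (- ((2 * c + e) * n))"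
    using \<open>0 < e\<close> by (simp add: powr_def)
  finally have "a \<le> C * exp (- ((2 * c + e) * n))"
    using a \<open>0 \<le> C\<close> by (meson mult_left_mono order_trans)
  moreover have p2: "exp (- (2 * c * n)) \<le> p\<^sup>2"
    using power_mono[OF p, of 2] by (simp add: algebra_simps flip: exp_double)
  ultimately have "4 * a / p\<^sup>2 \<le> 4 * (C * exp (- ((2 * c + e) * n))) / p\<^sup>2"
    by (intro divide_right_mono mult_left_mono) auto
  also have "\<dots> \<le> 4 * (C * exp (- ((2 * c + e) * n))) / exp (- (2 * c * n))"
    using p2 \<open>0 \<le> C\<close> pos by (intro divide_left_mono) auto
  also have "\<dots> = 4 * C * (exp (- ((2 * c + e) * n)) / exp (- (2 * c * n)))" by simp
  also have "exp (- ((2 * c + e) * n)) / exp (- (2 * c * n)) = exp (- e * n)"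
    by (simp add: algebra_simps flip: exp_diff)
  finally show ?thesis using first by (simp add: algebra_simps)
qed

lemma dist_scaleR_le:
  fixes u v y :: "'y::real_normed_vector"
  assumes "norm (u - v) / real n < \<eta>" "dist y (u /\<^sub>R real n) < r"
  shows "dist y (v /\<^sub>R real n) < r + \<eta>"
proof -
  have "dist (u /\<^sub>R real n) (v /\<^sub>R real n) = norm (u - v) / real n"
    by (simp add: dist_norm divide_inverse flip: scaleR_diff_right)
  then show ?thesis using assms dist_triangle[of y "v /\<^sub>R real n" "u /\<^sub>R real n"] by linarith
qed

context stationary_observations
begin

text \<open>Three nested balls of radii \<open>r < t < s\<close> are used: the law of the observations charges the first, the
  second then carries at least as much mass under the approximating observations, whose visits are controlled by
  mixing, and each such visit brings the true observation into the third. The loss from \<open>c\<close> to \<open>c'\<close> absorbs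
  the factor \<open>1/2\<close> left by Chebyshev's inequality.\<close>

lemma AE_liminf_log_rate_ball_ge:
  fixes y :: 'y
  assumes mixing: "\<And>h. 0 < h \<Longrightarrow> mixing_moment M E X h < \<infinity>"
    and S'_measurable: "\<And>n. 1 \<le> n \<Longrightarrow> S' n \<in> measurable (seq_space E) borel"
    and window: "\<And>n z z'. 1 \<le> n \<Longrightarrow> z \<in> space (seq_space E) \<Longrightarrow> z' \<in> space (seq_space E) \<Longrightarrow>
      (\<forall>i\<in>{1..2 * n}. z i = z' i) \<Longrightarrow> S' n z = S' n z'"
    and approx: "(\<lambda>n. SUP z\<in>space (seq_space E). ennreal (norm (S n z - S' n z) / real n)) \<longlonglongrightarrow> 0"
    and "r < s" "0 \<le> c" "c < c'"
    and ball: "- ereal c < liminf (log_rate (mu_law M X S) (ball y r))"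
    and growth: "ereal c < liminf (\<lambda>n. ereal (ln (real (k n)) / real n))"
  shows "AE \<omega> in M. - ereal c' \<le> liminf (log_rate (empirical \<omega>) (ball y s))"
proof -
  obtain d where d: "c < d" "ereal d < liminf (\<lambda>n. ereal (ln (real (k n)) / real n))"
    using ereal_dense2[OF growth] by auto
  define e where "e = (d - c) / 2"
  have "0 < e" using d by (simp add: e_def)
  obtain C where C: "0 \<le> C" "\<And>m. 1 \<le> m \<Longrightarrow> alpha_mix M E X m \<le> C * real m powr (- ((2 * c + e) / e))"
    using alpha_mix_polynomial_decay[OF _ mixing, of "(2 * c + e) / e"] \<open>0 < e\<close> \<open>0 \<le> c\<close>
    by (metis add_nonneg_pos divide_pos_pos mult_nonneg_nonneg zero_le_numeral)
  define \<eta> where "\<eta> = (s - r) / 2"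
  define t where "t = r + \<eta>"
  have \<eta>: "0 < \<eta>" "t + \<eta> = s" using \<open>r < s\<close> by (auto simp: \<eta>_def t_def)
  define f where "f n z = S' n z /\<^sub>R real n" for n z
  have f: "f n \<in> measurable (seq_space E) borel" if "1 \<le> n" for n
    unfolding f_def
    by (rule measurable_compose[OF S'_measurable[OF that]])
       (intro borel_measurable_continuous_onI continuous_intros)
  have f_window: "f n z = f n z'" if "1 \<le> n" "z \<in> space (seq_space E)" "z' \<in> space (seq_space E)"
      "\<forall>i\<in>{1..2 * n}. z i = z' i" for n z z'
    unfolding f_def using window[OF that] by simp
  define visits where
    "visits n \<omega> = (\<Sum>j=1..k n. indicat_real (ball y t) (f n ((shift ^^ ((j - 1) * n)) (path X \<omega>))))" for n \<omega>
  define p where "p n = prob {\<omega> \<in> space M. f n (path X \<omega>) \<in> ball y t}" for n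
  define good where "good n \<longleftrightarrow> 1 \<le> n \<and> exp (d * n) \<le> k n \<and> exp (- c * n) \<le> p n \<and>
      (\<forall>z\<in>space (seq_space E). norm (S n z - S' n z) / n < \<eta>)" for n
  have path_space: "(shift ^^ m) (path X \<omega>) \<in> space (seq_space E)" if "\<omega> \<in> space M" for m \<omega>
    using measurable_space[OF measurable_compose[OF measurable_path measurable_funpow_shift] that] .
  have ev_good: "\<forall>\<^sub>F n in sequentially. good n"
  proof -
    have "\<forall>\<^sub>F n in sequentially. (SUP z\<in>space (seq_space E). ennreal (norm (S n z - S' n z) / n)) < ennreal \<eta>"
      using \<eta> by (intro order_tendstoD(2)[OF approx]) auto
    then show ?thesis
      using less_LiminfD[OF d(2)] less_LiminfD[OF ball] eventually_ge_at_top[of 1]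
    proof eventually_elim
      case (elim n)
      have close: "norm (S n z - S' n z) / n < \<eta>" if "z \<in> space (seq_space E)" for z
      proof -
        have "ennreal (norm (S n z - S' n z) / n) < ennreal \<eta>"
          using SUP_upper[OF that, of "\<lambda>z. ennreal (norm (S n z - S' n z) / n)"] elim(1)
          by (rule le_less_trans)
        then show ?thesis by (simp add: ennreal_less_iff)
      qed
      have "d * n < ln (k n)" using elim by (simp add: field_simps)
      then have "exp (d * n) \<le> k n"
        using k_pos[OF elim(4)] by (metis exp_le_cancel_iff exp_ln less_imp_le of_nat_0_less_iff
            less_le_trans zero_less_one)
      moreover have "exp (- c * n) \<le> p n"
      proof -
        have "exp (- c * n) \<le> measure (completion (mu_law M X S n)) (ball y r)"
          using elim by (subst log_rate_le_iff(2)[symmetric]) (auto intro: less_imp_le)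
        also have "\<dots> = prob {\<omega> \<in> space M. S n (path X \<omega>) /\<^sub>R n \<in> ball y r}"
          using elim borel_prob_sequence.sets_eq[OF borel_prob_sequence_mu_law] measure_mu_law by simp
        also have "\<dots> \<le> p n"
          unfolding p_def
        proof (rule finite_measure_mono)
          show "{\<omega> \<in> space M. S n (path X \<omega>) /\<^sub>R n \<in> ball y r} \<subseteq> {\<omega> \<in> space M. f n (path X \<omega>) \<in> ball y t}"
          proof safe
            fix \<omega> assume "\<omega> \<in> space M" "S n (path X \<omega>) /\<^sub>R n \<in> ball y r"
            then show "f n (path X \<omega>) \<in> ball y t"
              using dist_scaleR_le[OF close[of "path X \<omega>"]] path_space[of \<omega> 0] by (simp add: f_def t_def)
          qed
          show "{\<omega> \<in> space M. f n (path X \<omega>) \<in> ball y t} \<in> events"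
            using prob_shifted_path(1)[OF f[OF elim(4)], of "ball y t" 0] by simp
        qed
        finally show ?thesis .
      qed
      ultimately show ?case using close elim(4) by (simp add: good_def)
    qed
  qed
  define A where "A n = (if good n then {\<omega> \<in> space M. visits n \<omega> \<le> k n * p n / 2} else {})" for n
  have A: "A n \<in> events \<and> prob (A n) \<le> (24 + 4 * C) * exp (- e * n)" for n
  proof (cases "good n")
    case True
    then have n: "1 \<le> n" and p: "exp (- c * n) \<le> p n" and kn: "exp (d * n) \<le> k n"
      by (auto simp: good_def)
    have p_pos: "0 < p n" using p by (meson exp_gt_zero less_le_trans)
    define l where "l = nat \<lceil>exp (e * n)\<rceil>"
    have "1 \<le> l" by (simp add: l_def Suc_le_eq)
    have B: "ball y t \<in> sets borel" by simp
    note few_visits = prob_few_visits_le[OF n f[OF n] _ B p_def[of n] p_pos k_pos[OF n] \<open>1 \<le> l\<close>]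
    have few: "{\<omega> \<in> space M. visits n \<omega> \<le> k n * p n / 2} \<in> events"
      unfolding visits_def by (rule few_visits(1), rule f_window[OF n])
    have "prob {\<omega> \<in> space M. visits n \<omega> \<le> k n * p n / 2}
        \<le> 8 * real (l + 1) / (real (k n) * p n) + 4 * alpha_mix M E X l / (p n)\<^sup>2"
      unfolding visits_def by (rule few_visits(2), rule f_window[OF n])
    also have "8 * real (l + 1) / (real (k n) * p n) + 4 * alpha_mix M E X l / (p n)\<^sup>2
        \<le> (24 + 4 * C) * exp (- e * n)"
      using \<open>0 \<le> c\<close> d(1) e_def kn p C(1) l_def C(2)[OF \<open>1 \<le> l\<close>] by (rule exponential_error_bound)
    finally show ?thesis using True few by (simp add: A_def)
  qed (use C in \<open>simp add: A_def\<close>)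
  have "AE \<omega> in M. \<forall>\<^sub>F n in sequentially. \<omega> \<notin> A n"
    using A \<open>0 < e\<close> by (intro AE_eventually_not_if_exponential[where e = e and C = "24 + 4 * C"]) auto
  then show ?thesis
    using AE_space
  proof eventually_elim
    case (elim \<omega>)
    have "\<forall>\<^sub>F n in sequentially. 2 \<le> exp ((c' - c) * real n)"
      using \<open>c < c'\<close> by real_asymp
    then have "\<forall>\<^sub>F n in sequentially. - ereal c' \<le> log_rate (empirical \<omega>) (ball y s) n"
      using elim(1) ev_good
    proof eventually_elim
      case (elim n)
      then have n: "1 \<le> n" and p: "exp (- c * n) \<le> p n"
        and close: "\<And>z. z \<in> space (seq_space E) \<Longrightarrow> norm (S n z - S' n z) / n < \<eta>"
        by (auto simp: good_def)
      have k: "0 < real (k n)" using k_pos[OF n] by simp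
      have "k n * p n / 2 < visits n \<omega>"
        using elim \<open>\<omega> \<in> space M\<close> by (simp add: A_def)
      also have "\<dots> \<le> (\<Sum>j=1..k n. indicat_real (ball y s) (sample X S \<omega> n j))"
        unfolding visits_def
      proof (rule sum_mono)
        fix j
        let ?z = "(shift ^^ ((j - 1) * n)) (path X \<omega>)"
        have "norm (S' n ?z - S n ?z) / n < \<eta>"
          using close[OF path_space[OF \<open>\<omega> \<in> space M\<close>]] by (simp add: norm_minus_commute)
        then have "f n ?z \<in> ball y t \<Longrightarrow> sample X S \<omega> n j \<in> ball y s"
          using dist_scaleR_le[of "S' n ?z" "S n ?z" n \<eta> y t] \<eta>(2) by (simp add: f_def sample_def)
        then show "indicat_real (ball y t) (f n ?z) \<le> indicat_real (ball y s) (sample X S \<omega> n j)"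
          by (simp add: indicator_def)
      qed
      also have "\<dots> = k n * measure (empirical \<omega> n) (ball y s)"
        using k k_pos[OF n] by (simp add: measure_empirical_measure)
      finally have "p n / 2 < measure (empirical \<omega> n) (ball y s)" using k by simp
      moreover have "exp (- c' * n) \<le> p n / 2"
      proof -
        have "exp (- c' * n) * 2 \<le> exp (- c' * n) * exp ((c' - c) * n)"
          using elim(1) by (intro mult_left_mono) auto
        also have "\<dots> = exp (- c * n)" by (simp add: algebra_simps flip: exp_add)
        finally show ?thesis using p by simp
      qed
      ultimately show ?case
        using log_rate_le_iff(2)[OF n, of "- c'" "empirical \<omega>" "ball y s"] by simp
    qed
    then show ?case by (rule Liminf_bounded)
  qed
qed

end

section \<open>The large deviation principle for the empirical measures\<close>

theorem theorem2p2:
  fixes M :: "'a measure" and E :: "'e measure"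
    and X :: "nat \<Rightarrow> 'a \<Rightarrow> 'e"
    and S :: "nat \<Rightarrow> (nat \<Rightarrow> 'e) \<Rightarrow> 'y::real_normed_vector"
    and k :: "nat \<Rightarrow> nat"
    and I :: "'y \<Rightarrow> ereal"
  assumes separable: "separable_space (euclidean :: 'y topology)"
    and prob: "prob_space M"
    and stationary: "stationary_process M E X"
    and S_measurable: "\<forall>n\<ge>1. S n \<in> measurable (seq_space E) borel"
    and k_pos: "\<forall>n\<ge>1. k n \<ge> 1"
    and k_mono: "mono_on {1..} k"
    and ldp: "LDP (mu_law M X S) I"
    and mixing: "\<forall>h>0. mixing_moment M E X h < \<infinity>"
    and approx: "\<exists>S' :: nat \<Rightarrow> (nat \<Rightarrow> 'e) \<Rightarrow> 'y.
        (\<forall>n\<ge>1. S' n \<in> measurable (seq_space E) borel \<and>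
          (\<forall>z\<in>space (seq_space E). \<forall>z'\<in>space (seq_space E).
             (\<forall>i\<in>{1..2 * n}. z i = z' i) \<longrightarrow> S' n z = S' n z')) \<and>
        (\<lambda>n. SUP z\<in>space (seq_space E). ennreal (norm (S n z - S' n z) / real n)) \<longlonglongrightarrow> 0"
    and growth:
      "((SUP x\<in>finite_domain I. I x) < \<infinity> \<and>
          (SUP x\<in>finite_domain I. I x) < liminf (\<lambda>n. ereal (ln (real (k n)) / real n))) \<or>
       filterlim (\<lambda>n. ln (real (k n)) / real n) at_top sequentially"
  shows "(AE \<omega> in M. weak_LDP (\<lambda>n. empirical_measure (k n) (sample X S \<omega> n)) I) \<and>
    (exponentially_tight (mu_law M X S) \<longrightarrow>
       (AE \<omega> in M. LDP (\<lambda>n. empirical_measure (k n) (sample X S \<omega> n)) I \<and> good_rate_function I))"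
proof -
  interpret prob_space M by (rule prob)
  interpret stationary_observations M E X S k
    using stationary S_measurable k_pos by unfold_locales (auto simp: stationary_process_def)
  \<comment> \<open>Each of the two growth conditions places all finite values of \<open>I\<close> below \<open>b\<close>.\<close>
  define b where "b = liminf (\<lambda>n. ereal (ln (real (k n)) / real n))"
  have below: "I x < b" if "I x < \<infinity>" for x
    using growth
  proof
    assume "(SUP x\<in>finite_domain I. I x) < \<infinity> \<and>
          (SUP x\<in>finite_domain I. I x) < liminf (\<lambda>n. ereal (ln (real (k n)) / real n))"
    moreover have "I x \<le> (SUP x\<in>finite_domain I. I x)"
      using that by (intro SUP_upper) (simp add: finite_domain_def)
    ultimately show ?thesis unfolding b_def by (meson le_less_trans)
  next
    assume "filterlim (\<lambda>n. ln (real (k n)) / real n) at_top sequentially"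
    then have "b = \<infinity>"
      unfolding b_def by (intro lim_imp_Liminf) (auto simp: tendsto_PInfty_eq_at_top)
    then show ?thesis using that by simp
  qed
  obtain D :: "'y set" where D: "countable D" "closure D = UNIV"
    using separable by (auto simp: separable_space_def)
  from approx obtain S' :: "nat \<Rightarrow> (nat \<Rightarrow> 'e) \<Rightarrow> 'y" where
    "\<forall>n\<ge>1. S' n \<in> measurable (seq_space E) borel \<and>
      (\<forall>z\<in>space (seq_space E). \<forall>z'\<in>space (seq_space E).
         (\<forall>i\<in>{1..2 * n}. z i = z' i) \<longrightarrow> S' n z = S' n z')"
    and S'_approx: "(\<lambda>n. SUP z\<in>space (seq_space E). ennreal (norm (S n z - S' n z) / real n)) \<longlonglongrightarrow> 0"
    by (elim exE conjE)
  then have S': "\<And>n. 1 \<le> n \<Longrightarrow> S' n \<in> measurable (seq_space E) borel"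
    "\<And>n z z'. 1 \<le> n \<Longrightarrow> z \<in> space (seq_space E) \<Longrightarrow> z' \<in> space (seq_space E) \<Longrightarrow>
      (\<forall>i\<in>{1..2 * n}. z i = z' i) \<Longrightarrow> S' n z = S' n z'"
    by blast+
  have rate: "rate_function I" and lower: "LDP_lower (mu_law M X S) I"
    using ldp by (auto simp: LDP_def)
  have completed: "B \<in> completed_borel" if "B \<in> sets borel" for B :: "'y set"
    using that borel_subset_completed_borel by blast

  have AE_lower: "AE \<omega> in M. LDP_lower (empirical \<omega>) I"
  proof -
    have ball: "AE \<omega> in M. - ereal c \<le> liminf (log_rate (empirical \<omega>) (ball y s))"
      if rs: "r < s" and x: "x \<in> ball y r" "I x < ereal c" and c: "ereal c < b" for y r s c x
    proof -
      obtain c0 where c0: "I x < ereal c0" "c0 < c" using ereal_dense2[OF x(2)] by auto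
      have "0 \<le> I x" using rate by (simp add: rate_function_def)
      then have "0 \<le> c0" using c0(1) by (metis ereal_less_eq(5) less_imp_le order_trans)
      have "(INF x \<in> ball y r. I x) < ereal c0"
        using x(1) c0(1) by (meson INF_lower le_less_trans)
      then have "- ereal c0 < - (INF x \<in> ball y r. I x)" by (simp only: ereal_minus_less_minus)
      also have "\<dots> \<le> liminf (log_rate (mu_law M X S) (ball y r))"
        using lower completed[of "ball y r"] unfolding LDP_lower_def
        by (metis borel_open interior_open open_ball)
      finally have "- ereal c0 < liminf (log_rate (mu_law M X S) (ball y r))" .
      moreover have "ereal c0 < b" using c0(2) c by (meson ereal_less(2) less_ereal.simps(1) less_trans)
      ultimately show ?thesis
        unfolding b_def
        by (intro AE_liminf_log_rate_ball_ge[OF mixing[rule_format] S' S'_approx rs \<open>0 \<le> c0\<close> c0(2)])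
    qed
    have "AE \<omega> in M. \<forall>y\<in>D. \<forall>r\<in>\<rat>. \<forall>s\<in>\<rat>. \<forall>c\<in>\<rat>. r < s \<and> (\<exists>x\<in>ball y r. I x < ereal c \<and> ereal c < b) \<longrightarrow>
        - ereal c \<le> liminf (log_rate (empirical \<omega>) (ball y s))"
      using ball D(1)
      by (intro AE_ball_countable[THEN iffD2] countable_rat ballI AE_impI) blast+
    then show ?thesis
    proof eventually_elim
      case (elim \<omega>)
      interpret borel_prob_sequence "empirical \<omega>" by (rule borel_prob_sequence_empirical)
      show ?case using D(2) elim below by (intro LDP_lower_from_balls[where D = D and b = b]) blast+
    qed
  qed

  have AE_compact: "AE \<omega> in M. \<forall>K. compact K \<longrightarrow> limsup (log_rate (empirical \<omega>) K) \<le> - (INF x \<in> K. I x)"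
  proof -
    have "AE \<omega> in M. \<forall>y\<in>D. \<forall>r\<in>\<rat>.
        limsup (log_rate (empirical \<omega>) (cball y r)) \<le> limsup (log_rate (mu_law M X S) (cball y r))"
      using D(1) by (intro AE_ball_countable[THEN iffD2] countable_rat ballI AE_limsup_log_rate_le) auto
    then show ?thesis
    proof eventually_elim
      case (elim \<omega>)
      interpret borel_prob_sequence "empirical \<omega>" by (rule borel_prob_sequence_empirical)
      have "limsup (log_rate (empirical \<omega>) (cball y r)) \<le> - (INF x \<in> cball y r. I x)"
        if "y \<in> D" "r \<in> \<rat>" for y r
      proof -
        have "limsup (log_rate (empirical \<omega>) (cball y r)) \<le> limsup (log_rate (mu_law M X S) (cball y r))"
          using elim that by blast
        also have "\<dots> \<le> - (INF x \<in> cball y r. I x)"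
          using ldp completed[of "cball y r"] unfolding LDP_def
          by (metis borel_closed closed_cball closure_closed)
        finally show ?thesis .
      qed
      moreover have "lsc I" using rate by (simp add: rate_function_def)
      ultimately show ?case using limsup_log_rate_compact[OF D(2)] by blast
    qed
  qed

  have "AE \<omega> in M. weak_LDP (empirical \<omega>) I"
    using AE_lower AE_compact
  proof eventually_elim
    case (elim \<omega>)
    have "limsup (log_rate (empirical \<omega>) \<Gamma>) \<le> - (INF x \<in> closure \<Gamma>. I x)" if "compact \<Gamma>" for \<Gamma>
      using elim(2) that closure_closed[OF compact_imp_closed[OF that]] by simp
    then show ?case using elim(1) rate unfolding weak_LDP_def by blast
  qed
  moreover have "AE \<omega> in M. LDP (empirical \<omega>) I \<and> good_rate_function I"
    if tight: "exponentially_tight (mu_law M X S)"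
  proof -
    have "\<forall>i::nat. \<exists>K. compact K \<and> limsup (log_rate (mu_law M X S) (- K)) \<le> - ereal i"
      using tight by (simp add: exponentially_tight_def)
    then obtain K where K: "\<And>i::nat. compact (K i)"
      "\<And>i. limsup (log_rate (mu_law M X S) (- K i)) \<le> - ereal (real i)"
      by metis
    have "AE \<omega> in M. \<forall>i. limsup (log_rate (empirical \<omega>) (- K i)) \<le> limsup (log_rate (mu_law M X S) (- K i))"
      using K(1) unfolding AE_all_countable
      by (intro allI AE_limsup_log_rate_le borel_comp borel_compact)
    then have AE_tight: "AE \<omega> in M. exponentially_tight (empirical \<omega>)"
    proof eventually_elim
      case (elim \<omega>)
      show ?case
        unfolding exponentially_tight_def
      proof (intro allI exI conjI)
        fix c :: real
        show "compact (K (nat \<lceil>c\<rceil>))" by (rule K)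
        have "limsup (log_rate (empirical \<omega>) (- K (nat \<lceil>c\<rceil>))) \<le> - ereal (real (nat \<lceil>c\<rceil>))"
          using elim K(2) order_trans by blast
        also have "\<dots> \<le> - ereal c" using of_nat_ceiling[of c] by simp
        finally show "limsup (log_rate (empirical \<omega>) (- K (nat \<lceil>c\<rceil>))) \<le> - ereal c" .
      qed
    qed
    show ?thesis
      using AE_lower AE_compact AE_tight
    proof eventually_elim
      case (elim \<omega>)
      interpret borel_prob_sequence "empirical \<omega>" by (rule borel_prob_sequence_empirical)
      have "limsup (log_rate (empirical \<omega>) \<Gamma>) \<le> - (INF x \<in> closure \<Gamma>. I x)" for \<Gamma>
        using elim by (intro limsup_log_rate_exponentially_tight) simp_all
      then show ?case
        using elim(1) rate exponentially_tight_imp_good_rate_function[OF rate lower tight]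
        by (simp add: LDP_def)
    qed
  qed
  ultimately show ?thesis by blast
qed

end
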